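(* Let $\alpha\in(0,1)$, $p\in[1,\infty]$, $\varepsilon\ge 0$, and let $F_0$ be a probability distribution on $\mathbb{R}^{d+1}$. Consider the problem $$\text{(P)}\qquad \inf_{\boldsymbol\beta\in\mathbb{R}^d,\ s\in\mathbb{R}}\ \sup_{F\in\mathbb{B}_p(F_0,\varepsilon)}\mathbb{E}^F\big[\ell_\alpha(Y-\boldsymbol\beta^\top\mathbf{X}-s)\big].$$ Then (P) is equivalent to the convex program $$\text{(R)}\qquad \min_{(\boldsymbol\beta,\overline{s})\in\mathbb{R}^{d+1}}\Big\{\mathbb{E}^{F_0}\big[\ell_\alpha(Y-\boldsymbol\beta^\top\mathbf{X}-\overline{s})\big]+c_{\alpha,p}\,\varepsilon\,\|\overline{\boldsymbol\beta}\|_*\Big\},$$ in the sense that (P) and (R) have the same optimal value, and if $(\boldsymbol\beta^*,\overline{s}^* )$ solves (R), then $(\boldsymbol\beta^*,s^* )$ is an optimal solution of (P), where $$s^*=\begin{cases}\overline{s}^*, & p=1,\\[2pt] \overline{s}^*+\dfrac{\varepsilon}{q}\big(\alpha^q-(1-\alpha)^q\big)\,c_{\alpha,p}^{1-q}\,\|\overline{\boldsymbol\beta^*}\|_*, & p\in(1,\infty].\end{cases}$$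
   Context: The check loss is $\ell_\alpha(u)=u(\alpha-\mathbf{1}_{\{u<0\}})=\alpha u_++(1-\alpha)u_-$, where $u_+=\max\{u,0\}$, $u_-=\max\{-u,0\}$. $q$ is the Hölder conjugate of $p$, $1/p+1/q=1$ (so $q=1$ when $p=\infty$). $\|\cdot\|$ is a fixed norm on $\mathbb{R}^{d+1}$ with dual norm $\|\mathbf{y}\|_*=\sup_{\|\mathbf{x}\|\le1}\mathbf{x}^\top\mathbf{y}$. For $\boldsymbol\beta\in\mathbb{R}^d$, $\overline{\boldsymbol\beta}=(\boldsymbol\beta,-1)\in\mathbb{R}^{d+1}$ (and $\overline{\boldsymbol\beta^*}=(\boldsymbol\beta^*,-1)$). The type-$p$ Wasserstein distance between distributions $F,G$ on $\mathbb{R}^{d+1}$ is $W_p(F,G)=\inf_\Pi(\mathbb{E}^\Pi\|\xi_1-\xi_2\|^p)^{1/p}$ for $p\in[1,\infty)$ and $W_\infty(F,G)=\inf_\Pi\operatorname{ess\,sup}^\Pi\|\xi_1-\xi_2\|$, where $\Pi$ ranges over joint distributions of $(\xi_1,\xi_2)$ with marginals $F$ and $G$. $\mathbb{B}_p(F_0,\varepsilon)$ is the set of all probability distributions $F$ on $\mathbb{R}^{d+1}$ with $W_p(F,F_0)\le\varepsilon$. $\mathbb{E}^F$ denotes expectation when $(\mathbf{X},Y)\in\mathbb{R}^d\times\mathbb{R}$ has distribution $F$. The constant $c_{\alpha,p}$ is $$c_{\alpha,p}=\begin{cases}\max\{\alpha,1-\alpha\},&p=1,\\ \big(\alpha^q(1-\alpha)+\alpha(1-\alpha)^q\big)^{1/q},&p\in(1,\infty),\\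 2\alpha(1-\alpha),&p=\infty.\end{cases}$$ *)

theory Defs
  imports "HOL-Probability.Probability"
begin

definition check_loss :: "real \<Rightarrow> real \<Rightarrow> real" where
  "check_loss \<alpha> u = u * (\<alpha> - indicator {..<0} u)"

definition is_norm :: "('a::real_vector \<Rightarrow> real) \<Rightarrow> bool" where
  "is_norm N \<longleftrightarrow>
     (\<forall>x. 0 \<le> N x) \<and> (\<forall>x. N x = 0 \<longleftrightarrow> x = 0) \<and>
     (\<forall>a x. N (a *\<^sub>R x) = \<bar>a\<bar> * N x) \<and> (\<forall>x y. N (x + y) \<le> N x + N y)"

definition dual_norm :: "('a::real_inner \<Rightarrow> real) \<Rightarrow> 'a \<Rightarrow> real" where
  "dual_norm N y = (SUP x\<in>{x. N x \<le> 1}. x \<bullet> y)"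

text \<open>Exponents live in \<^typ>\<open>ennreal\<close>, where \<open>1 / \<infinity> = 0\<close> and \<open>1 / 0 = \<infinity>\<close>; hence
  \<open>holder_conj 1 = \<infinity>\<close> and \<open>holder_conj \<infinity> = 1\<close>.\<close>

definition holder_conj :: "ennreal \<Rightarrow> ennreal" where
  "holder_conj p = 1 / (1 - 1 / p)"

lemma holder_conj_iff:
  assumes "1 \<le> p"
  shows "1 / p + 1 / q = 1 \<longleftrightarrow> q = holder_conj p"
proof -
  have le: "1 / p \<le> 1"
    using assms by (cases p) (auto simp: divide_ennreal ennreal_1[symmetric] simp del: ennreal_1)
  then have fin: "1 / p \<noteq> top"
    by (metis ennreal_one_neq_top neq_top_trans)
  show ?thesis
  proof
    assume h: "1 / p + 1 / q = 1"
    then have "1 / q = 1 - 1 / p"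
      using fin by (metis ennreal_add_diff_cancel_left)
    then show "q = holder_conj p"
      by (metis holder_conj_def one_divide_one_divide_ennreal)
  next
    assume "q = holder_conj p"
    then show "1 / p + 1 / q = 1"
      using le by (simp add: holder_conj_def add_diff_inverse_ennreal)
  qed
qed

definition check_const :: "real \<Rightarrow> ennreal \<Rightarrow> real" where
  "check_const \<alpha> p =
     (if p = 1 then max \<alpha> (1 - \<alpha>)
      else if p = \<infinity> then 2 * \<alpha> * (1 - \<alpha>)
      else let q = enn2real (holder_conj p)
           in (\<alpha> powr q * (1 - \<alpha>) + \<alpha> * (1 - \<alpha>) powr q) powr (1 / q))"

text \<open>Real powers of extended nonnegative reals; meant for exponents \<open>a > 0\<close> only.\<close>

definition ennreal_powr :: "ennreal \<Rightarrow> real \<Rightarrow> ennreal" where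
  "ennreal_powr x a = (if x = \<infinity> then \<infinity> else ennreal (enn2real x powr a))"

definition couplings :: "'a::topological_space measure \<Rightarrow> 'a measure \<Rightarrow> ('a \<times> 'a) measure set" where
  "couplings F G =
     {Q. prob_space Q \<and> sets Q = sets (borel \<Otimes>\<^sub>M borel) \<and>
         distr Q borel fst = F \<and> distr Q borel snd = G}"

definition wasserstein ::
  "('a::euclidean_space \<Rightarrow> real) \<Rightarrow> ennreal \<Rightarrow> 'a measure \<Rightarrow> 'a measure \<Rightarrow> ennreal" where
  "wasserstein N p F G =
     (if p = \<infinity>
      then (INF Q\<in>couplings F G. esssup Q (\<lambda>\<xi>. ennreal (N (fst \<xi> - snd \<xi>))))
      else (INF Q\<in>couplings F G.
              ennreal_powr (\<integral>\<^sup>+ \<xi>. ennreal (N (fst \<xi> - snd \<xi>) powr enn2real p) \<partial>Q)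
                (1 / enn2real p)))"

definition wasserstein_ball ::
  "('a::euclidean_space \<Rightarrow> real) \<Rightarrow> ennreal \<Rightarrow> 'a measure \<Rightarrow> real \<Rightarrow> 'a measure set" where
  "wasserstein_ball N p F\<^sub>0 \<epsilon> =
     {F. prob_space F \<and> sets F = sets borel \<and> wasserstein N p F F\<^sub>0 \<le> ennreal \<epsilon>}"

text \<open>The space of dimension \<open>d + 1\<close> is \<^typ>\<open>(real ^ 'd) \<times> real\<close>, with points \<open>(x, y)\<close>.
  The loss is nonnegative, so its expectation is a Lebesgue integral in \<open>[0, \<infinity>]\<close>; no moment of
  the distribution needs to exist.\<close>

definition exp_loss ::
  "real \<Rightarrow> ((real ^ 'd::finite) \<times> real) measure \<Rightarrow> (real ^ 'd) \<times> real \<Rightarrow> ennreal" where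
  "exp_loss \<alpha> F = (\<lambda>(\<beta>, s). \<integral>\<^sup>+ (x, y). ennreal (check_loss \<alpha> (y - \<beta> \<bullet> x - s)) \<partial>F)"

definition robust_objective ::
  "((real ^ 'd::finite) \<times> real \<Rightarrow> real) \<Rightarrow> real \<Rightarrow> ennreal \<Rightarrow> real \<Rightarrow>
   ((real ^ 'd) \<times> real) measure \<Rightarrow> (real ^ 'd) \<times> real \<Rightarrow> ennreal" where
  "robust_objective N \<alpha> p \<epsilon> F\<^sub>0 z = (SUP F\<in>wasserstein_ball N p F\<^sub>0 \<epsilon>. exp_loss \<alpha> F z)"

definition regularized_objective ::
  "((real ^ 'd::finite) \<times> real \<Rightarrow> real) \<Rightarrow> real \<Rightarrow> ennreal \<Rightarrow> real \<Rightarrow>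
   ((real ^ 'd) \<times> real) measure \<Rightarrow> (real ^ 'd) \<times> real \<Rightarrow> ennreal" where
  "regularized_objective N \<alpha> p \<epsilon> F\<^sub>0 z =
     exp_loss \<alpha> F\<^sub>0 z + ennreal (check_const \<alpha> p * \<epsilon> * dual_norm N (fst z, -1))"

definition solves :: "('a \<Rightarrow> ennreal) \<Rightarrow> 'a \<Rightarrow> bool" where
  "solves f = is_arg_min f (\<lambda>_. True)"

text \<open>The library's \<^const>\<open>convex_on\<close> only covers real-valued functions.\<close>

definition convex_fun :: "('a::real_vector \<Rightarrow> ennreal) \<Rightarrow> bool" where
  "convex_fun f \<longleftrightarrow>
     (\<forall>x y. \<forall>t\<in>{0<..<1}.
        f ((1 - t) *\<^sub>R x + t *\<^sub>R y) \<le> ennreal (1 - t) * f x + ennreal t * f y)"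

definition shifted_intercept ::
  "((real ^ 'd::finite) \<times> real \<Rightarrow> real) \<Rightarrow> real \<Rightarrow> ennreal \<Rightarrow> real \<Rightarrow> (real ^ 'd) \<Rightarrow> real \<Rightarrow> real" where
  "shifted_intercept N \<alpha> p \<epsilon> \<beta> s =
     (if p = 1 then s
      else let q = enn2real (holder_conj p)
           in s + \<epsilon> / q * (\<alpha> powr q - (1 - \<alpha>) powr q)
                    * check_const \<alpha> p powr (1 - q) * dual_norm N (\<beta>, -1))"

end

theory Submission
  imports Defs
begin

text \<open>
  Everything depends on the data only through the scalar residual. Write \<open>b = (-\<beta>, 1)\<close>, so that the
  residual of a point \<open>\<xi> = (x, y)\<close> is \<open>Z = \<xi> \<bullet> b = y - \<beta> \<bullet> x\<close>. Moving \<open>\<xi>\<close> by a vector \<open>v\<close> changes the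
  residual by at most \<open>D * N v\<close>, where \<open>D\<close> is the dual norm of \<open>b\<close>, and equality is attained in a suitable
  direction. So the adversary adds to \<open>Z\<close> a perturbation \<open>V\<close> whose \<open>p\<close>-norm is at most \<open>a = \<epsilon> * D\<close>. Let
  \<open>l\<close> be the check loss, \<open>c\<close> the constant \<open>check_const\<close> and \<open>q\<close> the conjugate exponent.

  Upper bound. For \<open>1 < p < \<infinity>\<close> there is a shift \<open>t\<close>, proportional to \<open>a\<close>, such that pointwise
  \<open>l (u + v - t) \<le> l u + a * c / q + (c * a powr (1 - p) / p) * \<bar>v\<bar> powr p\<close>: on each of the two
  branches of \<open>l\<close> this is Young's inequality, and \<open>t\<close> is the value that makes the two additive constants
  equal. The cases \<open>p = 1\<close> (with \<open>t = 0\<close>) and \<open>p = \<infinity>\<close> have analogous, simpler bounds.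
  Integrating against a coupling of transport cost \<open>\<epsilon>\<close> gives
  \<open>E l (Z + V - s - t) \<le> E l (Z - s) + c * a\<close>. Thus the robust objective at the shifted intercept is at most
  the regularised objective, for every \<open>(\<beta>, s)\<close> (\<open>robust_lin_loss_le\<close>). Since the Wasserstein distance
  is an infimum over couplings, a coupling of cost slightly above \<open>\<epsilon>\<close> is used, followed by a limit.

  Lower bound. Let \<open>p > 1\<close> and let \<open>t\<close> be an \<open>\<alpha>\<close>-quantile of \<open>Z\<close>. Splitting the atom at \<open>t\<close> randomly, one
  gets an event \<open>A\<close> of probability exactly \<open>1 - \<alpha>\<close> with \<open>Z \<ge> t\<close> on \<open>A\<close> and \<open>Z \<le> t\<close> off \<open>A\<close>. The slope
  \<open>g\<close>, equal to \<open>\<alpha>\<close> on \<open>A\<close> and to \<open>-(1 - \<alpha>)\<close> off \<open>A\<close>, has mean zero, so \<open>l (Z + V - s) \<ge> (Z + V - s) * g\<close> gives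
  \<open>E l (Z + V - s) \<ge> E l (Z - t) + E (V * g)\<close> for all \<open>s\<close> at once. The \<open>q\<close>-norm of \<open>g\<close> is \<open>c\<close>, and
  the \<open>V\<close> for which Hoelder's inequality is an equality makes \<open>E (V * g) = c * a\<close>
  (\<open>worst_case_exists\<close>). So a single law in the ball is bad for every intercept.
  For \<open>p = 1\<close> the two objectives coincide pointwise: a mass \<open>\<delta>\<close> is
  moved by the distance \<open>\<epsilon> / \<delta>\<close>, and \<open>\<delta>\<close> tends to zero (\<open>robust_lin_loss_ge_order_1\<close>).

  The two bounds give equality of the infima, and optimality of the shifted solution. A minimiser of
  the regularised problem exists although the objective may be infinite at some points and, for
  \<open>\<epsilon> = 0\<close>, constant along some directions: on the subspace where it is finite, the objective is Lipschitz and
  coercive with respect to one and the same seminorm (\<open>seminorm_coercive_attains_min\<close>).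
\<close>

section \<open>Seminorms on subspaces of a Euclidean space\<close>

text \<open>The carrier is a proper subspace in general, because the expected absolute value of a linear
  form is finite only on a subspace.\<close>

definition seminorm_on :: "'a::real_vector set \<Rightarrow> ('a \<Rightarrow> real) \<Rightarrow> bool" where
  "seminorm_on W P \<longleftrightarrow> subspace W \<and> (\<forall>x\<in>W. 0 \<le> P x) \<and>
     (\<forall>a. \<forall>x\<in>W. P (a *\<^sub>R x) = \<bar>a\<bar> * P x) \<and> (\<forall>x\<in>W. \<forall>y\<in>W. P (x + y) \<le> P x + P y)"

lemma seminorm_onD:
  assumes "seminorm_on W P"
  shows "subspace W" "\<And>x. x \<in> W \<Longrightarrow> 0 \<le> P x"
    "\<And>a x. x \<in> W \<Longrightarrow> P (a *\<^sub>R x) = \<bar>a\<bar> * P x"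
    "\<And>x y. x \<in> W \<Longrightarrow> y \<in> W \<Longrightarrow> P (x + y) \<le> P x + P y"
  using assms by (auto simp: seminorm_on_def)

lemma seminorm_on_zero: "seminorm_on W P \<Longrightarrow> P 0 = 0"
  using seminorm_onD(3)[of W P 0 0] seminorm_onD(1)[of W P] by (simp add: subspace_0)

lemma seminorm_on_sum:
  assumes "seminorm_on W P" "finite I" "\<And>i. i \<in> I \<Longrightarrow> f i \<in> W"
  shows "P (sum f I) \<le> (\<Sum>i\<in>I. P (f i))"
  using assms(2,3)
proof (induction I rule: finite_induct)
  case empty
  then show ?case using seminorm_on_zero[OF assms(1)] by simp
next
  case (insert i I)
  have "sum f I \<in> W"
    using insert.prems seminorm_onD(1)[OF assms(1)] by (intro subspace_sum) auto
  then have "P (f i + sum f I) \<le> P (f i) + P (sum f I)"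
    using seminorm_onD(4)[OF assms(1)] insert.prems by auto
  with insert show ?case by fastforce
qed

lemma seminorm_on_diff:
  assumes "seminorm_on W P" "x \<in> W" "y \<in> W"
  shows "\<bar>P x - P y\<bar> \<le> P (x - y)"
proof -
  note s = seminorm_onD[OF assms(1)]
  have d: "x - y \<in> W" using s(1) assms by (auto intro: subspace_diff)
  have "P (y - x) = P (x - y)" using s(3)[OF d, of "-1"] by simp
  moreover have "P (x - y + y) \<le> P (x - y) + P y" using s(4) d assms by blast
  moreover have "P (y - x + x) \<le> P (y - x) + P x"
    using s(4) subspace_diff[OF s(1) assms(3,2)] assms by blast
  ultimately show ?thesis by simp
qed

text \<open>Expanding in an orthonormal basis of the subspace bounds the seminorm by its values on the
  basis vectors.\<close>

lemma seminorm_on_le_norm: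
  fixes W :: "'a::euclidean_space set"
  assumes "seminorm_on W P"
  shows "\<exists>R>0. \<forall>x\<in>W. P x \<le> R * norm x"
proof -
  note s = seminorm_onD[OF assms]
  obtain B where B: "B \<subseteq> W" "pairwise orthogonal B" "\<And>x. x \<in> B \<Longrightarrow> norm x = 1"
      "independent B" "card B = dim W" "span B = W"
    using orthonormal_basis_subspace[OF s(1)] by metis
  have fin: "finite B" using B(4) by (rule independent_imp_finite)
  have "P x \<le> (1 + (\<Sum>i\<in>B. P i)) * norm x" if x: "x \<in> W" for x
  proof -
    have "x = (\<Sum>i\<in>B. (x \<bullet> i) *\<^sub>R i)"
      using orthonormal_basis_expand[OF B(2) B(3) _ fin] B(6) x by metis
    then have "P x \<le> (\<Sum>i\<in>B. P ((x \<bullet> i) *\<^sub>R i))"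
      using seminorm_on_sum[OF assms fin, of "\<lambda>i. (x \<bullet> i) *\<^sub>R i"] B(1) s(1)
      by (auto simp: subspace_scale subset_iff)
    also have "\<dots> \<le> (\<Sum>i\<in>B. norm x * P i)"
    proof (rule sum_mono)
      fix i assume i: "i \<in> B"
      have "\<bar>x \<bullet> i\<bar> \<le> norm x" using Cauchy_Schwarz_ineq2[of x i] B(3)[OF i] by simp
      moreover have "i \<in> W" using i B(1) by auto
      ultimately show "P ((x \<bullet> i) *\<^sub>R i) \<le> norm x * P i"
        using s(2)[of i] s(3)[of i "x \<bullet> i"] by (simp add: mult_right_mono)
    qed
    also have "\<dots> \<le> (1 + (\<Sum>i\<in>B. P i)) * norm x"
      by (simp add: sum_distrib_left algebra_simps)
    finally show ?thesis .
  qed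
  moreover have "0 \<le> (\<Sum>i\<in>B. P i)" using s(2) B(1) by (auto intro: sum_nonneg)
  ultimately show ?thesis by (intro exI[of _ "1 + (\<Sum>i\<in>B. P i)"]) auto
qed

lemma seminorm_on_continuous:
  fixes W :: "'a::euclidean_space set"
  assumes "seminorm_on W P"
    and "\<And>x y. x \<in> W \<Longrightarrow> y \<in> W \<Longrightarrow> \<bar>h x - h y\<bar> \<le> P (x - y)"
  shows "continuous_on W h"
proof -
  obtain R where R: "R > 0" "\<And>x. x \<in> W \<Longrightarrow> P x \<le> R * norm x"
    using seminorm_on_le_norm[OF assms(1)] by blast
  show ?thesis
  proof (rule lipschitz_on_continuous_on)
    show "R-lipschitz_on W h"
    proof (rule lipschitz_onI)
      fix x y assume xy: "x \<in> W" "y \<in> W"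
      then have "x - y \<in> W" using seminorm_onD(1)[OF assms(1)] by (auto intro: subspace_diff)
      then show "dist (h x) (h y) \<le> R * dist x y"
        using assms(2)[OF xy] R(2)[of "x - y"] by (simp add: dist_norm)
    qed (use R in simp)
  qed
qed

text \<open>A definite seminorm has a positive minimum on the compact unit sphere of the subspace.\<close>

lemma seminorm_on_ge_norm:
  fixes W :: "'a::euclidean_space set"
  assumes "seminorm_on W P" and def: "\<And>x. x \<in> W \<Longrightarrow> P x = 0 \<Longrightarrow> x = 0"
  shows "\<exists>k>0. \<forall>x\<in>W. k * norm x \<le> P x"
proof -
  note s = seminorm_onD[OF assms(1)]
  let ?S = "W \<inter> sphere 0 1"
  have cont: "continuous_on ?S P"
    using seminorm_on_continuous[OF assms(1) seminorm_on_diff[OF assms(1)]]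
    by (rule continuous_on_subset) auto
  have comp: "compact ?S"
    using closed_subspace[OF s(1)] by (simp add: closed_Int_compact)
  have "\<exists>k>0. \<forall>x\<in>?S. k \<le> P x"
  proof (cases "?S = {}")
    case False
    then obtain x0 where x0: "x0 \<in> ?S" "\<And>x. x \<in> ?S \<Longrightarrow> P x0 \<le> P x"
      using continuous_attains_inf[OF comp _ cont] by blast
    have "P x0 \<noteq> 0" using x0(1) def[of x0] by auto
    then show ?thesis using x0 s(2)[of x0] by (intro exI[of _ "P x0"]) auto
  qed (auto intro: exI[of _ 1])
  then obtain k where k: "k > 0" "\<And>x. x \<in> ?S \<Longrightarrow> k \<le> P x" by blast
  have "k * norm x \<le> P x" if "x \<in> W" for x
  proof (cases "x = 0")
    case False
    have "k \<le> P ((1 / norm x) *\<^sub>R x)"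
      using k(2) that False s(1) by (auto simp: subspace_scale)
    also have "\<dots> = P x / norm x" using s(3)[OF that] by simp
    finally show ?thesis using False by (simp add: field_simps)
  qed (use seminorm_on_zero[OF assms(1)] in simp)
  with k show ?thesis by blast
qed

text \<open>The Lipschitz condition makes \<open>h\<close> constant along the kernel of \<open>P\<close>. It therefore suffices to
  minimise over the orthogonal complement of the kernel in \<open>W\<close>, where \<open>P\<close> is equivalent to the Euclidean
  norm; there \<open>h\<close> is continuous and coercive in the usual sense.\<close>

lemma seminorm_coercive_attains_min:
  fixes W :: "'a::euclidean_space set"
  assumes P: "seminorm_on W P"
    and lip: "\<And>x y. x \<in> W \<Longrightarrow> y \<in> W \<Longrightarrow> \<bar>h x - h y\<bar> \<le> P (x - y)"
    and coercive: "m > 0" "\<And>x. x \<in> W \<Longrightarrow> m * P x - C \<le> h x"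
  shows "\<exists>x\<in>W. \<forall>y\<in>W. h x \<le> h y"
proof -
  note s = seminorm_onD[OF P]
  let ?K = "{x \<in> W. P x = 0}"
  have K: "subspace ?K"
    unfolding subspace_def
  proof (intro conjI ballI allI)
    show "0 \<in> ?K" using seminorm_on_zero[OF P] s(1) by (simp add: subspace_0)
    fix x y assume "x \<in> ?K" "y \<in> ?K"
    then show "x + y \<in> ?K" using s(2)[of "x + y"] s(4)[of x y] s(1) by (auto simp: subspace_add)
  next
    fix c x assume "x \<in> ?K"
    then show "c *\<^sub>R x \<in> ?K" using s(1,3) by (auto simp: subspace_scale)
  qed
  let ?U = "W \<inter> {y. \<forall>x\<in>?K. orthogonal x y}"
  have U: "subspace ?U" by (intro subspace_inter s(1) subspace_orthogonal_to_vectors)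
  have PU: "seminorm_on ?U P" using P U by (auto simp: seminorm_on_def)
  have "x = 0" if "x \<in> ?U" "P x = 0" for x
  proof -
    have "orthogonal x x" using that by auto
    then show ?thesis by (simp add: orthogonal_self)
  qed
  then obtain k where k: "k > 0" "\<And>x. x \<in> ?U \<Longrightarrow> k * norm x \<le> P x"
    using seminorm_on_ge_norm[OF PU] by blast
  \<comment> \<open>Outside the ball of radius r the coercivity bound already forces h to exceed h 0.\<close>
  define r where "r = \<bar>h 0 + C\<bar> / (m * k)"
  let ?T = "?U \<inter> cball 0 r"
  have "compact ?T" using closed_subspace[OF U] by (simp add: closed_Int_compact)
  moreover have "continuous_on ?T h"
    using seminorm_on_continuous[OF P lip] by (rule continuous_on_subset) auto
  moreover have 0: "0 \<in> ?T" using subspace_0[OF U] k coercive by (simp add: r_def)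
  ultimately obtain x where x: "x \<in> ?T" "\<And>y. y \<in> ?T \<Longrightarrow> h x \<le> h y"
    using continuous_attains_inf[of ?T h] by blast
  have "h x \<le> h y" if y: "y \<in> W" for y
  proof -
    obtain u v where uv: "u \<in> span ?K" "\<And>w. w \<in> span ?K \<Longrightarrow> orthogonal v w" "y = u + v"
      using orthogonal_subspace_decomp_exists[of ?K y] by blast
    have u: "u \<in> ?K" using uv(1) K by (simp add: span_eq_iff[THEN iffD2])
    have v: "v \<in> ?U"
    proof -
      have "v = y - u" using uv by simp
      then have "v \<in> W" using y u s(1) by (auto intro: subspace_diff)
      then show ?thesis using uv(2) by (auto simp: orthogonal_commute intro: span_base)
    qed
    have "\<bar>h y - h v\<bar> \<le> P u" using lip[of y v] y v uv(3) by auto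
    then have hv: "h y = h v" using u by simp
    show ?thesis
    proof (cases "norm v \<le> r")
      case True
      then show ?thesis using x(2)[of v] v hv by simp
    next
      case False
      have "h 0 + C \<le> m * k * r" using k coercive by (simp add: r_def)
      also have "\<dots> \<le> m * (k * norm v)" using False k coercive by simp
      also have "\<dots> \<le> m * P v" using k(2)[OF v] coercive by simp
      finally have "h 0 \<le> h v" using coercive(2)[of v] v by auto
      then show ?thesis using x(2)[OF 0] hv by simp
    qed
  qed
  then show ?thesis using x by blast
qed

section \<open>Dual norms\<close>

lemma is_norm_seminorm_on: "is_norm N \<Longrightarrow> seminorm_on UNIV N"
  by (simp add: is_norm_def seminorm_on_def)

lemma is_norm_equiv:
  fixes N :: "'a::euclidean_space \<Rightarrow> real"
  assumes "is_norm N"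
  shows "\<exists>k>0. \<forall>x. k * norm x \<le> N x"
  using seminorm_on_ge_norm[OF is_norm_seminorm_on[OF assms]] assms by (auto simp: is_norm_def)

lemma is_norm_continuous:
  fixes N :: "'a::euclidean_space \<Rightarrow> real"
  assumes "is_norm N"
  shows "continuous_on UNIV N"
  by (rule seminorm_on_continuous[OF is_norm_seminorm_on[OF assms]
        seminorm_on_diff[OF is_norm_seminorm_on[OF assms]]])

lemma is_norm_zero: "is_norm N \<Longrightarrow> N 0 = 0"
  by (simp add: is_norm_def)

lemma is_norm_minus: "is_norm N \<Longrightarrow> N (- x) = N x"
  unfolding is_norm_def by (metis abs_neg_one mult_1 scaleR_minus1_left)

text \<open>All norms on a Euclidean space are equivalent, so the unit ball of \<open>N\<close> is compact and the
  supremum that defines the dual norm is a maximum.\<close>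

lemma dual_norm_attained:
  fixes N :: "'a::euclidean_space \<Rightarrow> real"
  assumes "is_norm N"
  shows "\<exists>e. N e \<le> 1 \<and> e \<bullet> y = dual_norm N y"
    and "N x \<le> 1 \<Longrightarrow> x \<bullet> y \<le> dual_norm N y"
proof -
  let ?B = "{x. N x \<le> 1}"
  obtain k where k: "k > 0" "\<And>x. k * norm x \<le> N x" using is_norm_equiv[OF assms] by blast
  have "norm x \<le> 1 / k" if "N x \<le> 1" for x
    using k(1) order_trans[OF k(2) that] by (simp add: field_simps)
  then have bdd: "bounded ?B" by (auto simp: bounded_iff)
  have "closed ?B"
    using continuous_closed_preimage[OF is_norm_continuous[OF assms] closed_UNIV, of "{..1}"]
    by (simp add: vimage_def)
  with bdd have comp: "compact ?B" by (simp add: compact_eq_bounded_closed)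
  have ne: "0 \<in> ?B" using is_norm_zero[OF assms] by simp
  have "continuous_on ?B (\<lambda>x. x \<bullet> y)" by (intro continuous_intros)
  then obtain e where e: "e \<in> ?B" "\<And>x. x \<in> ?B \<Longrightarrow> x \<bullet> y \<le> e \<bullet> y"
    using continuous_attains_sup[OF comp] ne by blast
  have "dual_norm N y = e \<bullet> y"
    unfolding dual_norm_def using e by (intro cSup_eq_maximum) auto
  then show "\<exists>e. N e \<le> 1 \<and> e \<bullet> y = dual_norm N y" "N x \<le> 1 \<Longrightarrow> x \<bullet> y \<le> dual_norm N y"
    using e by auto
qed

lemma dual_norm_nonneg:
  fixes N :: "'a::euclidean_space \<Rightarrow> real"
  assumes "is_norm N"
  shows "0 \<le> dual_norm N y"
  using dual_norm_attained(2)[OF assms, of 0 y] is_norm_zero[OF assms] by simp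

lemma dual_norm_holder:
  fixes N :: "'a::euclidean_space \<Rightarrow> real"
  assumes "is_norm N"
  shows "\<bar>x \<bullet> y\<bar> \<le> dual_norm N y * N x"
proof -
  have *: "x \<bullet> y \<le> dual_norm N y * N x" for x
  proof (cases "x = 0")
    case False
    then have pos: "N x > 0" using assms by (metis is_norm_def order_less_le)
    have "N ((1 / N x) *\<^sub>R x) \<le> 1" using assms pos by (simp add: is_norm_def)
    from dual_norm_attained(2)[OF assms this] show ?thesis using pos by (simp add: field_simps)
  qed (use is_norm_zero[OF assms] in simp)
  show ?thesis using *[of x] *[of "-x"] is_norm_minus[OF assms, of x] by simp
qed

lemma dual_norm_pos:
  fixes N :: "'a::euclidean_space \<Rightarrow> real"
  assumes "is_norm N" "y \<noteq> 0"
  shows "0 < dual_norm N y"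
proof (rule ccontr)
  assume "\<not> ?thesis"
  then have "dual_norm N y = 0" using dual_norm_nonneg[OF assms(1), of y] by simp
  then have "\<bar>y \<bullet> y\<bar> \<le> 0" using dual_norm_holder[OF assms(1), of y y] by simp
  then have "y \<bullet> y = 0" by linarith
  then show False using assms(2) by simp
qed

lemma dual_norm_leI:
  fixes N :: "'a::euclidean_space \<Rightarrow> real"
  assumes "is_norm N" "\<And>x. N x \<le> 1 \<Longrightarrow> x \<bullet> y \<le> c"
  shows "dual_norm N y \<le> c"
  using dual_norm_attained(1)[OF assms(1), of y] assms(2) by force

lemma seminorm_on_dual_norm:
  fixes N :: "'a::euclidean_space \<Rightarrow> real"
  assumes N: "is_norm N"
  shows "seminorm_on UNIV (dual_norm N)"
proof -
  have tri: "dual_norm N (x + y) \<le> dual_norm N x + dual_norm N y" for x y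
    by (rule dual_norm_leI[OF N]) (auto simp: inner_add_right intro: add_mono dual_norm_attained(2)[OF N])
  have le: "dual_norm N (a *\<^sub>R y) \<le> \<bar>a\<bar> * dual_norm N y" for a y
  proof (rule dual_norm_leI[OF N])
    fix x assume x: "N x \<le> 1"
    have "x \<bullet> (a *\<^sub>R y) \<le> \<bar>a\<bar> * \<bar>x \<bullet> y\<bar>" by (metis abs_ge_self abs_mult inner_scaleR_right)
    also have "\<dots> \<le> \<bar>a\<bar> * dual_norm N y"
    proof (rule mult_left_mono)
      have "\<bar>x \<bullet> y\<bar> \<le> dual_norm N y * N x" by (rule dual_norm_holder[OF N])
      also have "\<dots> \<le> dual_norm N y" using x dual_norm_nonneg[OF N, of y] by (simp add: mult_left_le)
      finally show "\<bar>x \<bullet> y\<bar> \<le> dual_norm N y" .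
    qed simp
    finally show "x \<bullet> (a *\<^sub>R y) \<le> \<bar>a\<bar> * dual_norm N y" .
  qed
  have "dual_norm N (a *\<^sub>R y) = \<bar>a\<bar> * dual_norm N y" for a y
  proof (cases "a = 0")
    case True
    then show ?thesis using le[of 0 y] dual_norm_nonneg[OF N, of 0] by simp
  next
    case False
    have "\<bar>a\<bar> * dual_norm N ((1 / a) *\<^sub>R (a *\<^sub>R y)) \<le> \<bar>a\<bar> * (\<bar>1 / a\<bar> * dual_norm N (a *\<^sub>R y))"
      by (intro mult_left_mono le) simp
    then show ?thesis using False le[of a y] by simp
  qed
  then show ?thesis using tri dual_norm_nonneg[OF N] by (simp add: seminorm_on_def)
qed

lemma dual_norm_minus:
  fixes N :: "'a::euclidean_space \<Rightarrow> real"
  assumes "is_norm N"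
  shows "dual_norm N (- y) = dual_norm N y"
  using seminorm_onD(3)[OF seminorm_on_dual_norm[OF assms], of y "-1"] by simp

section \<open>The check loss\<close>

context
  fixes \<alpha> :: real
  assumes \<alpha>: "0 < \<alpha>" "\<alpha> < 1"
begin

lemma check_loss_eq_max: "check_loss \<alpha> u = max (\<alpha> * u) (- (1 - \<alpha>) * u)"
proof (cases "u < 0")
  case True
  have "\<alpha> * u \<le> 0" "0 \<le> - (1 - \<alpha>) * u"
    using True \<alpha> by (auto simp: mult_le_0_iff zero_le_mult_iff)
  then show ?thesis using True by (simp add: check_loss_def max_def algebra_simps)
next
  case False
  have "0 \<le> \<alpha> * u" "- (1 - \<alpha>) * u \<le> 0"
    using False \<alpha> by (auto simp: mult_le_0_iff)
  then show ?thesis using False by (simp add: check_loss_def max_def algebra_simps)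
qed

lemma check_loss_nonneg: "0 \<le> check_loss \<alpha> u"
  unfolding check_loss_def using \<alpha> by (auto simp: indicator_def mult_nonpos_nonpos)

lemma check_loss_ge_slope: "\<alpha> * u \<le> check_loss \<alpha> u" "- (1 - \<alpha>) * u \<le> check_loss \<alpha> u"
  by (auto simp: check_loss_eq_max)

lemma check_loss_add_le: "check_loss \<alpha> (u + v) \<le> check_loss \<alpha> u + check_loss \<alpha> v"
  using check_loss_ge_slope[of u] check_loss_ge_slope[of v]
  unfolding check_loss_eq_max[of "u + v"] by (simp add: algebra_simps)

lemma check_loss_scale: "0 \<le> c \<Longrightarrow> check_loss \<alpha> (c * u) = c * check_loss \<alpha> u"
  by (auto simp: check_loss_def indicator_def mult_less_0_iff)

lemma check_loss_le_max_abs: "check_loss \<alpha> u \<le> max \<alpha> (1 - \<alpha>) * \<bar>u\<bar>"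
proof -
  have "\<alpha> * u \<le> \<alpha> * \<bar>u\<bar>" "(1 - \<alpha>) * (- u) \<le> (1 - \<alpha>) * \<bar>u\<bar>"
    using \<alpha> by (intro mult_left_mono; simp)+
  moreover have "\<alpha> * \<bar>u\<bar> \<le> max \<alpha> (1 - \<alpha>) * \<bar>u\<bar>" "(1 - \<alpha>) * \<bar>u\<bar> \<le> max \<alpha> (1 - \<alpha>) * \<bar>u\<bar>"
    by (auto intro: mult_right_mono)
  ultimately have "\<alpha> * u \<le> max \<alpha> (1 - \<alpha>) * \<bar>u\<bar>" "- (1 - \<alpha>) * u \<le> max \<alpha> (1 - \<alpha>) * \<bar>u\<bar>"
    using minus_mult_minus[of "1 - \<alpha>" u] by (metis minus_mult_commute order_trans)+
  then show ?thesis unfolding check_loss_eq_max by (rule max.boundedI)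
qed

lemma check_loss_le_abs: "check_loss \<alpha> u \<le> \<bar>u\<bar>"
  using check_loss_le_max_abs[of u] mult_right_mono[of "max \<alpha> (1 - \<alpha>)" 1 "\<bar>u\<bar>"] \<alpha> by linarith

lemma check_loss_lipschitz: "\<bar>check_loss \<alpha> u - check_loss \<alpha> v\<bar> \<le> \<bar>u - v\<bar>"
  using check_loss_add_le[of v "u - v"] check_loss_add_le[of u "v - u"]
    check_loss_le_abs[of "u - v"] check_loss_le_abs[of "v - u"] by simp

text \<open>Finiteness of the expected loss is equivalent to integrability of the residual by this bound,
  and it also gives the coercivity of the expected loss.\<close>

lemma check_loss_ge_min_abs: "min \<alpha> (1 - \<alpha>) * \<bar>u\<bar> \<le> check_loss \<alpha> u"
proof (cases "u < 0")
  case True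
  have "min \<alpha> (1 - \<alpha>) * \<bar>u\<bar> \<le> (1 - \<alpha>) * \<bar>u\<bar>" by (rule mult_right_mono) auto
  also have "\<dots> = - (1 - \<alpha>) * u" using True by (simp add: algebra_simps)
  finally show ?thesis using check_loss_ge_slope(2) by (rule order_trans)
next
  case False
  have "min \<alpha> (1 - \<alpha>) * \<bar>u\<bar> \<le> \<alpha> * \<bar>u\<bar>" by (rule mult_right_mono) auto
  also have "\<dots> = \<alpha> * u" using False by simp
  finally show ?thesis using check_loss_ge_slope(1) by (rule order_trans)
qed

end

lemma check_loss_measurable [measurable]: "check_loss \<alpha> \<in> borel_measurable borel"
  unfolding check_loss_def[abs_def] by measurable

section \<open>Upper bound on the worst-case loss\<close>

text \<open>The expected loss with a general coefficient vector \<open>b\<close> instead of \<open>(-\<beta>, 1)\<close>; the bounds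
  below do not depend on the form of \<open>b\<close>.\<close>

definition lin_loss :: "real \<Rightarrow> 'a::euclidean_space measure \<Rightarrow> 'a \<Rightarrow> real \<Rightarrow> ennreal" where
  "lin_loss \<alpha> F b s = (\<integral>\<^sup>+ \<xi>. ennreal (check_loss \<alpha> (\<xi> \<bullet> b - s)) \<partial>F)"

text \<open>The optimal intercept moves by this coefficient times \<open>\<epsilon> * dual_norm N b\<close>.\<close>

definition shift_coeff :: "real \<Rightarrow> ennreal \<Rightarrow> real" where
  "shift_coeff \<alpha> p =
     (if p = 1 then 0
      else let q = enn2real (holder_conj p)
           in (\<alpha> powr q - (1 - \<alpha>) powr q) * check_const \<alpha> p powr (1 - q) / q)"

lemma holder_conj_top: "holder_conj \<infinity> = 1"
  by (simp add: holder_conj_def)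

lemma holder_conj_ennreal:
  assumes "1 < r"
  shows "holder_conj (ennreal r) = ennreal (r / (r - 1))"
proof -
  have "1 / ennreal r = ennreal (1 / r)"
    using assms by (simp add: divide_ennreal flip: ennreal_1)
  then have "1 - 1 / ennreal r = ennreal (1 - 1 / r)"
    using assms by (simp add: ennreal_minus flip: ennreal_1)
  also have "1 - 1 / r = (r - 1) / r" using assms by (simp add: field_simps)
  finally show ?thesis
    using assms by (simp add: holder_conj_def divide_ennreal flip: ennreal_1)
qed

lemma ennreal_ge_1_cases:
  fixes p :: ennreal
  assumes "1 \<le> p"
  obtains (one) "p = 1" | (finite) r where "p = ennreal r" "1 < r" | (infinite) "p = \<infinity>"
proof (cases p)
  case (real r)
  then have "1 \<le> r" using assms by (metis ennreal_1 ennreal_le_iff)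
  then show ?thesis using one finite real by (cases "r = 1") auto
qed (use infinite in auto)

context
  fixes \<alpha> :: real
  assumes \<alpha>: "0 < \<alpha>" "\<alpha> < 1"
begin

text \<open>The constant \<open>c\<close> is the \<open>q\<close>-norm of the random variable that equals \<open>\<alpha>\<close> with probability
  \<open>1 - \<alpha>\<close> and \<open>-(1 - \<alpha>)\<close> with probability \<open>\<alpha>\<close>; this is how it arises in both bounds.\<close>

lemma check_const_finite:
  assumes "1 < r"
  defines "q \<equiv> r / (r - 1)"
  defines "c \<equiv> check_const \<alpha> (ennreal r)"
  shows "1 < q" "1 / r + 1 / q = 1" "0 < c"
    "c powr q = \<alpha> powr q * (1 - \<alpha>) + \<alpha> * (1 - \<alpha>) powr q"
    "shift_coeff \<alpha> (ennreal r) = (\<alpha> powr q - (1 - \<alpha>) powr q) * c powr (1 - q) / q"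
proof -
  show q: "1 < q" "1 / r + 1 / q = 1" using assms(1) by (auto simp: q_def field_simps)
  have ne: "ennreal r \<noteq> 1" using assms(1) by simp
  have eq: "enn2real (holder_conj (ennreal r)) = q"
    using assms(1) by (simp add: holder_conj_ennreal q_def)
  have c: "c = (\<alpha> powr q * (1 - \<alpha>) + \<alpha> * (1 - \<alpha>) powr q) powr (1 / q)"
    using ne eq by (simp add: c_def check_const_def)
  have pos: "0 < \<alpha> powr q * (1 - \<alpha>) + \<alpha> * (1 - \<alpha>) powr q" using \<alpha> by (simp add: add_pos_pos)
  then show "0 < c" by (simp add: c)
  show "c powr q = \<alpha> powr q * (1 - \<alpha>) + \<alpha> * (1 - \<alpha>) powr q"
    using pos q(1) by (simp add: c powr_powr)
  show "shift_coeff \<alpha> (ennreal r) = (\<alpha> powr q - (1 - \<alpha>) powr q) * c powr (1 - q) / q"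
    using ne eq by (simp add: shift_coeff_def c_def)
qed

lemma check_const_nonneg: "1 \<le> p \<Longrightarrow> 0 \<le> check_const \<alpha> p"
proof (erule ennreal_ge_1_cases)
  fix r :: real assume "p = ennreal r" "1 < r"
  then show ?thesis using check_const_finite(3)[of r] by simp
qed (use \<alpha> in \<open>auto simp: check_const_def\<close>)

text \<open>A certificate of Lagrangian duality: \<open>L\<close> is the multiplier of the transport budget. When the
  perturbations have \<open>p\<close>-th moment at most \<open>a powr p\<close>, integration turns the right-hand side into
  the expected loss plus \<open>c * a\<close>, whatever the distribution of \<open>u\<close>.\<close>

lemma shifted_check_loss_le_finite:
  assumes "1 \<le> p" "p \<noteq> \<infinity>" "0 < a"
  shows "\<exists>A L. 0 \<le> A \<and> 0 \<le> L \<and> A + L * a powr enn2real p = check_const \<alpha> p * a \<and>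
    (\<forall>u v. check_loss \<alpha> (u + v - shift_coeff \<alpha> p * a) \<le> check_loss \<alpha> u + A + L * \<bar>v\<bar> powr enn2real p)"
  using assms(1)
proof (cases p rule: ennreal_ge_1_cases)
  case one
  have "check_loss \<alpha> (u + v) \<le> check_loss \<alpha> u + max \<alpha> (1 - \<alpha>) * \<bar>v\<bar>" for u v
    using check_loss_add_le[OF \<alpha>, of u v] check_loss_le_max_abs[OF \<alpha>, of v] by simp
  then show ?thesis using one \<alpha> assms(3)
    by (intro exI[of _ 0] exI[of _ "max \<alpha> (1 - \<alpha>)"])
      (simp add: check_const_def shift_coeff_def)
next
  case (finite r)
  define q where "q = r / (r - 1)"
  define c where "c = check_const \<alpha> (ennreal r)"
  note c = check_const_finite[OF finite(2), folded q_def c_def]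
  \<comment> \<open>The pair k, L gives g * x \<le> k * g powr q + L * x powr r for both slopes g.\<close>
  define k where "k = a * c powr (1 - q) / q"
  define L where "L = c * a powr (1 - r) / r"
  have k: "0 \<le> k" using assms(3) c by (simp add: k_def)
  have L: "0 \<le> L" using c finite by (simp add: L_def)
  \<comment> \<open>With the shift t = k * (\<alpha> powr q - (1 - \<alpha>) powr q), the branch with slope \<alpha> leaves the constant
    k * \<alpha> powr q - \<alpha> * t and the other one k * (1 - \<alpha>) powr q + (1 - \<alpha>) * t; both are equal to this value.\<close>
  have kc: "k * (\<alpha> powr q * (1 - \<alpha>) + \<alpha> * (1 - \<alpha>) powr q) = a * c / q"
  proof -
    have "c powr (1 - q) * c powr q = c" using c(3) by (simp flip: powr_add)
    then show ?thesis unfolding c(4)[symmetric] k_def by (simp add: mult.assoc)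
  qed
  have sh: "shift_coeff \<alpha> p * a = k * (\<alpha> powr q - (1 - \<alpha>) powr q)"
    using c(5) finite(1) by (simp add: k_def mult_ac)
  have young: "g * x \<le> k * g powr q + L * x powr r" if "0 \<le> g" "0 \<le> x" for g x
  proof -
    \<comment> \<open>The scaling by a and c makes the equality case of Young's inequality match the optimal
      perturbation.\<close>
    have "(x / a) * (g / c) \<le> (x / a) powr r / r + (g / c) powr q / q"
      using that c assms(3) finite(2) by (intro Youngs_inequality) auto
    then have "a * c * ((x / a) * (g / c)) \<le> a * c * ((x / a) powr r / r + (g / c) powr q / q)"
      using c(3) assms(3) by (intro mult_left_mono) auto
    also have "\<dots> = k * g powr q + L * x powr r"
      using that c(3) assms(3) by (simp add: k_def L_def powr_divide powr_diff field_simps)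
    also have "a * c * ((x / a) * (g / c)) = g * x"
      using c(3) assms(3) by simp
    finally show ?thesis .
  qed
  have "check_loss \<alpha> (u + v - shift_coeff \<alpha> p * a) \<le> check_loss \<alpha> u + a * c / q + L * \<bar>v\<bar> powr r" for u v
  proof -
    have "\<alpha> * v \<le> \<alpha> * \<bar>v\<bar>" "(1 - \<alpha>) * (- v) \<le> (1 - \<alpha>) * \<bar>v\<bar>"
      using \<alpha> by (intro mult_left_mono; simp)+
    then have "\<alpha> * v \<le> k * \<alpha> powr q + L * \<bar>v\<bar> powr r"
      "(1 - \<alpha>) * (- v) \<le> k * (1 - \<alpha>) powr q + L * \<bar>v\<bar> powr r"
      using young[of \<alpha> "\<bar>v\<bar>"] young[of "1 - \<alpha>" "\<bar>v\<bar>"] \<alpha> by linarith+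
    then show ?thesis
      using check_loss_ge_slope[OF \<alpha>, of u]
      unfolding sh kc[symmetric] check_loss_eq_max[OF \<alpha>, of "u + v - k * (\<alpha> powr q - (1 - \<alpha>) powr q)"]
      by (simp add: algebra_simps)
  qed
  moreover have "a * c / q + L * a powr r = c * a"
  proof -
    have "L * a powr r = c * a / r" using assms(3) by (simp add: L_def flip: powr_add)
    then have "a * c / q + L * a powr r = c * a * (1 / r + 1 / q)" by (simp add: field_simps)
    then show ?thesis using c(2) by simp
  qed
  ultimately show ?thesis using finite L c assms(3)
    by (intro exI[of _ "a * c / q"] exI[of _ L]) (simp add: c_def)
qed (use assms(2) in simp)

text \<open>For \<open>p = \<infinity>\<close> the shift is \<open>(2 * \<alpha> - 1) * a\<close>, which balances the worst cases \<open>v = a\<close> and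
  \<open>v = -a\<close>.\<close>

lemma shifted_check_loss_le_infinite:
  assumes "\<bar>v\<bar> \<le> a"
  shows "check_loss \<alpha> (u + v - shift_coeff \<alpha> \<infinity> * a) \<le> check_loss \<alpha> u + check_const \<alpha> \<infinity> * a"
proof -
  have "0 < check_const \<alpha> \<infinity>" using \<alpha> by (simp add: check_const_def)
  then have sh: "shift_coeff \<alpha> \<infinity> = 2 * \<alpha> - 1"
    using \<alpha> unfolding shift_coeff_def holder_conj_top by simp
  have "\<alpha> * v \<le> \<alpha> * a" "(1 - \<alpha>) * (- v) \<le> (1 - \<alpha>) * a"
    using \<alpha> assms by (intro mult_left_mono; simp)+
  then show ?thesis
    using check_loss_ge_slope[OF \<alpha>, of u]
    unfolding sh check_loss_eq_max[OF \<alpha>, of "u + v - (2 * \<alpha> - 1) * a"]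
    by (simp add: check_const_def algebra_simps)
qed

end

lemma ennreal_powr_le_iff:
  assumes "0 < r" "0 \<le> b"
  shows "ennreal_powr x (1 / r) \<le> ennreal b \<longleftrightarrow> x \<le> ennreal (b powr r)"
proof (cases x)
  case (real t)
  have "t powr (1 / r) \<le> b \<longleftrightarrow> t \<le> b powr r"
  proof
    assume "t powr (1 / r) \<le> b"
    then have "(t powr (1 / r)) powr r \<le> b powr r" using assms by (intro powr_mono2) auto
    then show "t \<le> b powr r" using real assms by (simp add: powr_powr)
  next
    assume "t \<le> b powr r"
    then have "t powr (1 / r) \<le> (b powr r) powr (1 / r)" using real assms by (intro powr_mono2) auto
    then show "t powr (1 / r) \<le> b" using assms by (simp add: powr_powr)
  qed
  then show ?thesis using real assms by (simp add: ennreal_powr_def)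
qed (simp add: ennreal_powr_def top_unique)

text \<open>The bound on the cost of a single coupling that underlies \<open>wasserstein N p F G \<le> \<rho>\<close>, freed
  from the root and from the infimum.\<close>

definition transport_le :: "('a::euclidean_space \<Rightarrow> real) \<Rightarrow> ennreal \<Rightarrow> ('a \<times> 'a) measure \<Rightarrow> real \<Rightarrow> bool" where
  "transport_le N p Q \<rho> \<longleftrightarrow>
     (if p = \<infinity> then (AE \<xi> in Q. N (fst \<xi> - snd \<xi>) \<le> \<rho>)
      else (\<integral>\<^sup>+ \<xi>. ennreal (N (fst \<xi> - snd \<xi>) powr enn2real p) \<partial>Q) \<le> ennreal (\<rho> powr enn2real p))"

lemma is_norm_measurable:
  fixes N :: "'a::euclidean_space \<Rightarrow> real"
  shows "is_norm N \<Longrightarrow> N \<in> borel_measurable borel"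
  using borel_measurable_continuous_onI is_norm_continuous by blast

lemma coupling_measurable:
  assumes "Q \<in> couplings F G" "f \<in> borel_measurable (borel \<Otimes>\<^sub>M borel)"
  shows "f \<in> borel_measurable Q"
  using assms by (simp add: couplings_def cong: measurable_cong_sets)

lemma transport_le_imp_wasserstein_le:
  fixes N :: "'a::euclidean_space \<Rightarrow> real"
  assumes N: "is_norm N" and p: "1 \<le> p" and \<rho>: "0 \<le> \<rho>"
    and Q: "Q \<in> couplings F G" "transport_le N p Q \<rho>"
  shows "wasserstein N p F G \<le> ennreal \<rho>"
proof (cases "p = \<infinity>")
  case True
  have [measurable]: "N \<in> borel_measurable borel" by (rule is_norm_measurable[OF N])
  have "esssup Q (\<lambda>\<xi>. ennreal (N (fst \<xi> - snd \<xi>))) \<le> ennreal \<rho>"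
  proof (rule esssup_I)
    show "(\<lambda>\<xi>. ennreal (N (fst \<xi> - snd \<xi>))) \<in> borel_measurable Q"
      by (rule coupling_measurable[OF Q(1)]) measurable
    show "AE \<xi> in Q. ennreal (N (fst \<xi> - snd \<xi>)) \<le> ennreal \<rho>"
      using Q(2) True by (auto simp: transport_le_def intro: ennreal_leI)
  qed
  then show ?thesis using Q(1) True by (auto simp: wasserstein_def intro: INF_lower2)
next
  case False
  then have "0 < enn2real p" using p by (cases p) (auto simp: ennreal_1[symmetric] simp del: ennreal_1)
  then show ?thesis using Q False \<rho>
    by (auto simp: wasserstein_def transport_le_def ennreal_powr_le_iff intro!: INF_lower2[OF Q(1)])
qed

text \<open>A radius strictly above the infimum over couplings is undercut by some coupling.\<close>

lemma wasserstein_le_imp_transport_le: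
  fixes N :: "'a::euclidean_space \<Rightarrow> real"
  assumes N: "is_norm N" and p: "1 \<le> p" and \<rho>: "0 \<le> \<epsilon>" "\<epsilon> < \<rho>"
    and W: "wasserstein N p F G \<le> ennreal \<epsilon>"
  shows "\<exists>Q\<in>couplings F G. transport_le N p Q \<rho>"
proof (cases "p = \<infinity>")
  case True
  have "wasserstein N p F G < ennreal \<rho>" using W \<rho> by (simp add: le_less_trans ennreal_less_iff)
  then obtain Q where Q: "Q \<in> couplings F G"
    and "esssup Q (\<lambda>\<xi>. ennreal (N (fst \<xi> - snd \<xi>))) < ennreal \<rho>"
    using True by (auto simp: wasserstein_def INF_less_iff)
  then have "AE \<xi> in Q. ennreal (N (fst \<xi> - snd \<xi>)) < ennreal \<rho>"
    using esssup_AE[of "\<lambda>\<xi>. ennreal (N (fst \<xi> - snd \<xi>))" Q] by (auto elim: eventually_mono)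
  then have "AE \<xi> in Q. N (fst \<xi> - snd \<xi>) \<le> \<rho>"
    using N by (auto elim!: eventually_mono simp: is_norm_def ennreal_less_iff)
  then show ?thesis using Q True by (auto simp: transport_le_def)
next
  case False
  then have pos: "0 < enn2real p" using p by (cases p) (auto simp: ennreal_1[symmetric] simp del: ennreal_1)
  have "wasserstein N p F G < ennreal \<rho>" using W \<rho> by (simp add: le_less_trans ennreal_less_iff)
  then obtain Q where Q: "Q \<in> couplings F G"
    and W': "ennreal_powr (\<integral>\<^sup>+ \<xi>. ennreal (N (fst \<xi> - snd \<xi>) powr enn2real p) \<partial>Q) (1 / enn2real p) < ennreal \<rho>"
    using False by (auto simp: wasserstein_def INF_less_iff)
  then have "(\<integral>\<^sup>+ \<xi>. ennreal (N (fst \<xi> - snd \<xi>) powr enn2real p) \<partial>Q) \<le> ennreal (\<rho> powr enn2real p)"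
    using less_imp_le[OF W'] ennreal_powr_le_iff[OF pos, of \<rho>] \<rho> by simp
  then show ?thesis using Q False by (auto simp: transport_le_def)
qed

lemma nn_integral_coupling:
  assumes "Q \<in> couplings F G"
  shows "f \<in> borel_measurable borel \<Longrightarrow> (\<integral>\<^sup>+ \<xi>. f (fst \<xi>) \<partial>Q) = (\<integral>\<^sup>+ x. f x \<partial>F)"
    and "f \<in> borel_measurable borel \<Longrightarrow> (\<integral>\<^sup>+ \<xi>. f (snd \<xi>) \<partial>Q) = (\<integral>\<^sup>+ x. f x \<partial>G)"
proof -
  have Q: "sets Q = sets (borel \<Otimes>\<^sub>M borel)" "distr Q borel fst = F" "distr Q borel snd = G"
    using assms by (auto simp: couplings_def)
  have [measurable]: "fst \<in> measurable Q borel" "snd \<in> measurable Q borel"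
    unfolding measurable_cong_sets[OF Q(1) refl] by measurable
  assume f: "f \<in> borel_measurable borel"
  show "(\<integral>\<^sup>+ \<xi>. f (fst \<xi>) \<partial>Q) = (\<integral>\<^sup>+ x. f x \<partial>F)"
    using f unfolding Q(2)[symmetric] by (subst nn_integral_distr) auto
  show "(\<integral>\<^sup>+ \<xi>. f (snd \<xi>) \<partial>Q) = (\<integral>\<^sup>+ x. f x \<partial>G)"
    using f unfolding Q(3)[symmetric] by (subst nn_integral_distr) auto
qed

text \<open>Apply the pointwise bound to the residual \<open>u\<close> of the second component and its change \<open>v\<close>, and
  integrate over the coupling. By Hoelder's inequality \<open>\<bar>v\<bar>\<close> is at most the dual norm times the length of
  the transport.\<close>

lemma lin_loss_coupling_le:
  fixes N :: "'a::euclidean_space \<Rightarrow> real"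
  assumes N: "is_norm N" and \<alpha>: "0 < \<alpha>" "\<alpha> < 1" and p: "1 \<le> p" and \<rho>: "0 < \<rho>" and b: "b \<noteq> 0"
    and Q: "Q \<in> couplings F G" "transport_le N p Q \<rho>"
  defines "a \<equiv> \<rho> * dual_norm N b"
  shows "lin_loss \<alpha> F b (s + shift_coeff \<alpha> p * a) \<le> lin_loss \<alpha> G b s + ennreal (check_const \<alpha> p * a)"
proof -
  let ?l = "check_loss \<alpha>"
  let ?D = "dual_norm N b"
  let ?u = "\<lambda>\<xi>::'a \<times> 'a. snd \<xi> \<bullet> b - s"
  let ?v = "\<lambda>\<xi>::'a \<times> 'a. (fst \<xi> - snd \<xi>) \<bullet> b"
  note [measurable] = check_loss_measurable is_norm_measurable[OF N]
  interpret Q: prob_space Q using Q(1) by (simp add: couplings_def)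
  have D: "0 < ?D" by (rule dual_norm_pos[OF N b])
  then have a: "0 < a" using \<rho> by (simp add: a_def)
  have v: "\<bar>?v \<xi>\<bar> \<le> ?D * N (fst \<xi> - snd \<xi>)" for \<xi> by (rule dual_norm_holder[OF N])
  have F: "lin_loss \<alpha> F b (s + shift_coeff \<alpha> p * a) =
      (\<integral>\<^sup>+ \<xi>. ennreal (?l (?u \<xi> + ?v \<xi> - shift_coeff \<alpha> p * a)) \<partial>Q)"
    unfolding lin_loss_def
    by (subst nn_integral_coupling(1)[OF Q(1), symmetric])
      (auto simp: inner_diff_left algebra_simps intro!: nn_integral_cong)
  have G: "lin_loss \<alpha> G b s = (\<integral>\<^sup>+ \<xi>. ennreal (?l (?u \<xi>)) \<partial>Q)"
    unfolding lin_loss_def by (subst nn_integral_coupling(2)[OF Q(1), symmetric]) auto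
  have meas: "(\<lambda>\<xi>. ennreal (?l (?u \<xi>))) \<in> borel_measurable Q"
    "(\<lambda>\<xi>. ennreal (N (fst \<xi> - snd \<xi>) powr r)) \<in> borel_measurable Q" for r
    by (rule coupling_measurable[OF Q(1)]; measurable)+
  show ?thesis
  proof (cases "p = \<infinity>")
    case True
    then have "AE \<xi> in Q. N (fst \<xi> - snd \<xi>) \<le> \<rho>" using Q(2) by (simp add: transport_le_def)
    then have "AE \<xi> in Q. \<bar>?v \<xi>\<bar> \<le> a"
    proof (rule eventually_mono)
      fix \<xi> assume "N (fst \<xi> - snd \<xi>) \<le> \<rho>"
      then have "?D * N (fst \<xi> - snd \<xi>) \<le> a" using D by (simp add: a_def mult.commute)
      with v[of \<xi>] show "\<bar>?v \<xi>\<bar> \<le> a" by simp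
    qed
    then have "AE \<xi> in Q. ennreal (?l (?u \<xi> + ?v \<xi> - shift_coeff \<alpha> p * a))
        \<le> ennreal (?l (?u \<xi>)) + ennreal (check_const \<alpha> p * a)"
      by (rule eventually_mono)
        (use True shifted_check_loss_le_infinite[OF \<alpha>] check_loss_nonneg[OF \<alpha>] check_const_nonneg[OF \<alpha> p] a
          in \<open>simp flip: ennreal_plus\<close>)
    then have "lin_loss \<alpha> F b (s + shift_coeff \<alpha> p * a)
        \<le> (\<integral>\<^sup>+ \<xi>. ennreal (?l (?u \<xi>)) + ennreal (check_const \<alpha> p * a) \<partial>Q)"
      unfolding F by (rule nn_integral_mono_AE)
    also have "\<dots> = lin_loss \<alpha> G b s + ennreal (check_const \<alpha> p * a)"
      unfolding G using meas by (simp add: nn_integral_add Q.emeasure_space_1)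
    finally show ?thesis .
  next
    case False
    define r where "r = enn2real p"
    have r: "0 \<le> r" by (simp add: r_def)
    obtain A L where AL: "0 \<le> A" "0 \<le> L" "A + L * a powr r = check_const \<alpha> p * a"
      "\<And>u v. ?l (u + v - shift_coeff \<alpha> p * a) \<le> ?l u + A + L * \<bar>v\<bar> powr r"
      using shifted_check_loss_le_finite[OF \<alpha> p False a] unfolding r_def by blast
    have "lin_loss \<alpha> F b (s + shift_coeff \<alpha> p * a) \<le>
      (\<integral>\<^sup>+ \<xi>. ennreal (?l (?u \<xi>)) + (ennreal A + ennreal (L * ?D powr r) * ennreal (N (fst \<xi> - snd \<xi>) powr r)) \<partial>Q)"
      unfolding F
    proof (rule nn_integral_mono)
      fix \<xi>
      have "\<bar>?v \<xi>\<bar> powr r \<le> ?D powr r * N (fst \<xi> - snd \<xi>) powr r"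
        using powr_mono2[OF r _ v[of \<xi>]] D N by (simp add: powr_mult is_norm_def)
      then have "L * \<bar>?v \<xi>\<bar> powr r \<le> L * (?D powr r * N (fst \<xi> - snd \<xi>) powr r)"
        using AL(2) by (rule mult_left_mono)
      then have "?l (?u \<xi> + ?v \<xi> - shift_coeff \<alpha> p * a)
          \<le> ?l (?u \<xi>) + (A + (L * ?D powr r) * N (fst \<xi> - snd \<xi>) powr r)"
        using AL(4)[of "?u \<xi>" "?v \<xi>"] by simp
      then have "ennreal (?l (?u \<xi> + ?v \<xi> - shift_coeff \<alpha> p * a))
          \<le> ennreal (?l (?u \<xi>) + (A + (L * ?D powr r) * N (fst \<xi> - snd \<xi>) powr r))"
        by (rule ennreal_leI)
      also have "\<dots> = ennreal (?l (?u \<xi>)) + (ennreal A + ennreal (L * ?D powr r) * ennreal (N (fst \<xi> - snd \<xi>) powr r))"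
        using AL(1,2) check_loss_nonneg[OF \<alpha>] by (simp add: ennreal_mult')
      finally show "ennreal (?l (?u \<xi> + ?v \<xi> - shift_coeff \<alpha> p * a)) \<le> \<dots>" .
    qed
    also have "\<dots> = lin_loss \<alpha> G b s + (ennreal A + ennreal (L * ?D powr r) * (\<integral>\<^sup>+ \<xi>. ennreal (N (fst \<xi> - snd \<xi>) powr r) \<partial>Q))"
      unfolding G using meas by (simp add: nn_integral_add nn_integral_cmult Q.emeasure_space_1)
    also have "\<dots> \<le> lin_loss \<alpha> G b s + (ennreal A + ennreal (L * ?D powr r) * ennreal (\<rho> powr r))"
      using Q(2) False by (intro add_left_mono mult_left_mono) (auto simp: transport_le_def r_def)
    also have "ennreal A + ennreal (L * ?D powr r) * ennreal (\<rho> powr r) = ennreal (A + L * a powr r)"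
      using AL(1,2) D \<rho> by (simp add: a_def powr_mult mult_ac flip: ennreal_mult' ennreal_plus)
    finally show ?thesis using AL(3) by simp
  qed
qed

lemma lin_loss_lipschitz_intercept:
  fixes F :: "'a::euclidean_space measure"
  assumes \<alpha>: "0 < \<alpha>" "\<alpha> < 1" and F: "prob_space F" "sets F = sets borel"
  shows "lin_loss \<alpha> F b s \<le> lin_loss \<alpha> F b t + ennreal \<bar>s - t\<bar>"
proof -
  interpret prob_space F by fact
  note [measurable_cong] = F(2)
  note [measurable] = check_loss_measurable
  have "lin_loss \<alpha> F b s \<le> (\<integral>\<^sup>+ \<xi>. ennreal (check_loss \<alpha> (\<xi> \<bullet> b - t)) + ennreal \<bar>s - t\<bar> \<partial>F)"
    unfolding lin_loss_def
  proof (rule nn_integral_mono)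
    fix \<xi> :: 'a
    have "check_loss \<alpha> (\<xi> \<bullet> b - s) \<le> check_loss \<alpha> (\<xi> \<bullet> b - t) + \<bar>s - t\<bar>"
      using check_loss_lipschitz[OF \<alpha>, of "\<xi> \<bullet> b - s" "\<xi> \<bullet> b - t"] by simp
    then show "ennreal (check_loss \<alpha> (\<xi> \<bullet> b - s)) \<le> ennreal (check_loss \<alpha> (\<xi> \<bullet> b - t)) + ennreal \<bar>s - t\<bar>"
      using check_loss_nonneg[OF \<alpha>] by (simp add: ennreal_leI flip: ennreal_plus)
  qed
  also have "\<dots> = lin_loss \<alpha> F b t + ennreal \<bar>s - t\<bar>"
    unfolding lin_loss_def by (subst nn_integral_add) (auto simp: emeasure_space_1)
  finally show ?thesis .
qed

text \<open>Use couplings of cost \<open>\<epsilon> + \<delta>\<close>. The shift that belongs to radius \<open>\<epsilon> + \<delta>\<close> differs from the one for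
  \<open>\<epsilon>\<close> by a multiple of \<open>\<delta>\<close>, which the Lipschitz continuity in the intercept absorbs. This also
  covers \<open>\<epsilon> = 0\<close>, where the pointwise bound is not available directly.\<close>

lemma robust_lin_loss_le:
  fixes N :: "'a::euclidean_space \<Rightarrow> real"
  assumes N: "is_norm N" and \<alpha>: "0 < \<alpha>" "\<alpha> < 1" and p: "1 \<le> p" and \<epsilon>: "0 \<le> \<epsilon>" and b: "b \<noteq> 0"
    and F: "F \<in> wasserstein_ball N p G \<epsilon>"
  shows "lin_loss \<alpha> F b (s + shift_coeff \<alpha> p * (\<epsilon> * dual_norm N b))
    \<le> lin_loss \<alpha> G b s + ennreal (check_const \<alpha> p * (\<epsilon> * dual_norm N b))" (is "?lhs \<le> ?R")
proof (rule ennreal_le_epsilon)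
  let ?D = "dual_norm N b"
  have D: "0 < ?D" by (rule dual_norm_pos[OF N b])
  have F': "prob_space F" "sets F = sets borel" "wasserstein N p F G \<le> ennreal \<epsilon>"
    using F by (auto simp: wasserstein_ball_def)
  fix e :: real assume e: "0 < e"
  \<comment> \<open>M bounds the sensitivity of all error terms to the slack \<delta>; the summand 1 keeps it positive.\<close>
  define M where "M = check_const \<alpha> p * ?D + \<bar>shift_coeff \<alpha> p\<bar> * ?D + 1"
  define \<delta> where "\<delta> = e / M"
  note c = check_const_nonneg[OF \<alpha> p]
  have M: "0 < M" using c D by (simp add: M_def add_nonneg_pos)
  then have \<delta>: "0 < \<delta>" using e by (simp add: \<delta>_def)
  obtain Q where Q: "Q \<in> couplings F G" "transport_le N p Q (\<epsilon> + \<delta>)"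
    using wasserstein_le_imp_transport_le[OF N p \<epsilon> _ F'(3), of "\<epsilon> + \<delta>"] \<delta> by auto
  have "?lhs \<le> lin_loss \<alpha> F b (s + shift_coeff \<alpha> p * ((\<epsilon> + \<delta>) * ?D)) + ennreal (\<bar>shift_coeff \<alpha> p\<bar> * ?D * \<delta>)"
    using lin_loss_lipschitz_intercept[OF \<alpha> F'(1,2), of b "s + shift_coeff \<alpha> p * (\<epsilon> * ?D)" "s + shift_coeff \<alpha> p * ((\<epsilon> + \<delta>) * ?D)"]
      D \<delta> by (simp add: algebra_simps abs_mult)
  also have "\<dots> \<le> lin_loss \<alpha> G b s + ennreal (check_const \<alpha> p * ((\<epsilon> + \<delta>) * ?D)) + ennreal (\<bar>shift_coeff \<alpha> p\<bar> * ?D * \<delta>)"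
    using lin_loss_coupling_le[OF N \<alpha> p _ b Q] \<epsilon> \<delta> by (intro add_right_mono) auto
  also have "\<dots> = lin_loss \<alpha> G b s + ennreal (check_const \<alpha> p * (\<epsilon> * ?D) + (M - 1) * \<delta>)"
    using c D \<epsilon> \<delta> by (simp add: M_def algebra_simps flip: ennreal_plus)
  also have "\<dots> \<le> lin_loss \<alpha> G b s + ennreal (check_const \<alpha> p * (\<epsilon> * ?D) + e)"
  proof -
    have "(M - 1) * \<delta> \<le> M * \<delta>" using \<delta> by simp
    also have "M * \<delta> = e" using M by (simp add: \<delta>_def)
    finally show ?thesis by (intro add_left_mono ennreal_leI) simp
  qed
  also have "\<dots> = ?R + ennreal e" using c \<epsilon> D e by (simp add: add.assoc)
  finally show "?lhs \<le> ?R + ennreal e" .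
qed

section \<open>Lower bound on the worst-case loss\<close>

text \<open>Every point \<open>x\<close> is moved by \<open>v1\<close> with probability \<open>w x\<close> and by \<open>v2\<close> otherwise. The coin is realised
  by a factor \<open>bool\<close> carrying the conditional probabilities as a density, so atoms of \<open>G\<close> can be split.\<close>

lemma split_law:
  fixes G :: "'a::euclidean_space measure"
  assumes G: "prob_space G" "sets G = sets borel"
    and w: "w \<in> borel_measurable borel" "\<And>x. 0 \<le> w x" "\<And>x. w x \<le> (1::real)"
  shows "\<exists>Q F. Q \<in> couplings F G \<and> prob_space F \<and> sets F = sets borel \<and>
    (\<forall>f\<in>borel_measurable (borel \<Otimes>\<^sub>M borel). (\<integral>\<^sup>+ \<xi>. f \<xi> \<partial>Q) =
       (\<integral>\<^sup>+ x. ennreal (w x) * f (x + v1, x) + ennreal (1 - w x) * f (x + v2, x) \<partial>G))"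
proof -
  interpret G: prob_space G by fact
  note [measurable_cong] = G(2)
  note [measurable] = w(1)
  let ?C = "count_space (UNIV :: bool set)"
  interpret C: sigma_finite_measure ?C by (rule sigma_finite_measure_count_space_finite) simp
  define W where "W = (\<lambda>(x::'a, c). ennreal (if c then w x else 1 - w x))"
  define T where "T = (\<lambda>(x::'a, c). (x + (if c then v1 else v2), x))"
  have [measurable]: "W \<in> borel_measurable (G \<Otimes>\<^sub>M ?C)" unfolding W_def by measurable
  have [measurable]: "T \<in> measurable (G \<Otimes>\<^sub>M ?C) (borel \<Otimes>\<^sub>M borel)" unfolding T_def by measurable
  define Q where "Q = distr (density (G \<Otimes>\<^sub>M ?C) W) (borel \<Otimes>\<^sub>M borel) T"
  have Qs: "sets Q = sets (borel \<Otimes>\<^sub>M borel)" by (simp add: Q_def)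
  have nn: "(\<integral>\<^sup>+ \<xi>. f \<xi> \<partial>Q) =
       (\<integral>\<^sup>+ x. ennreal (w x) * f (x + v1, x) + ennreal (1 - w x) * f (x + v2, x) \<partial>G)"
    if [measurable]: "f \<in> borel_measurable (borel \<Otimes>\<^sub>M borel)" for f
  proof -
    have "(\<integral>\<^sup>+ \<xi>. f \<xi> \<partial>Q) = (\<integral>\<^sup>+ z. W z * f (T z) \<partial>(G \<Otimes>\<^sub>M ?C))"
      unfolding Q_def by (simp add: nn_integral_distr nn_integral_density)
    also have "\<dots> = (\<integral>\<^sup>+ x. (\<integral>\<^sup>+ c. W (x, c) * f (T (x, c)) \<partial>?C) \<partial>G)"
      by (subst C.nn_integral_fst[symmetric]) auto
    finally show ?thesis
      by (simp add: nn_integral_count_space_finite UNIV_bool W_def T_def add.commute)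
  qed
  have w1: "ennreal (w x) * y + ennreal (1 - w x) * y = y" for x y
    using w(2,3)[of x] by (simp add: ennreal_plus[symmetric] distrib_right[symmetric] del: ennreal_plus)
  have one: "emeasure Q (space Q) = 1"
    using nn[of "\<lambda>_. 1"] w1[of _ 1] by (simp add: G.emeasure_space_1)
  interpret Q: prob_space Q by (rule prob_spaceI[OF one])
  define F where "F = distr Q borel fst"
  have [measurable]: "fst \<in> measurable Q borel" "snd \<in> measurable Q borel"
    unfolding measurable_cong_sets[OF Qs refl] by measurable
  have "distr Q borel snd = G"
  proof (rule measure_eqI)
    fix A assume "A \<in> sets (distr Q borel snd)"
    then have A [measurable]: "A \<in> sets borel" by simp
    have "emeasure (distr Q borel snd) A = (\<integral>\<^sup>+ x. indicator A x \<partial>distr Q borel snd)"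
      by simp
    also have "\<dots> = (\<integral>\<^sup>+ \<xi>. indicator A (snd \<xi>) \<partial>Q)" by (subst nn_integral_distr) auto
    also have "\<dots> = (\<integral>\<^sup>+ x. indicator A x \<partial>G)" by (subst nn) (auto simp: w1)
    also have "\<dots> = emeasure G A" using G(2) by simp
    finally show "emeasure (distr Q borel snd) A = emeasure G A" .
  qed (simp add: G)
  then have "Q \<in> couplings F G"
    using Q.prob_space_axioms Qs by (simp add: couplings_def F_def)
  moreover have "prob_space F" unfolding F_def by (rule Q.prob_space_distr) simp
  moreover have "sets F = sets borel" by (simp add: F_def)
  ultimately show ?thesis using nn by blast
qed

text \<open>Two constant displacements suffice for all adversarial laws below; their transport cost depends
  on \<open>w\<close> only through its mean.\<close>

lemma split_law_in_ball:
  fixes N :: "'a::euclidean_space \<Rightarrow> real"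
  assumes N: "is_norm N" and p: "1 \<le> p" and \<epsilon>: "0 \<le> \<epsilon>"
    and G: "prob_space G" "sets G = sets borel"
    and w: "w \<in> borel_measurable borel" "\<And>x. 0 \<le> w x" "\<And>x. w x \<le> (1::real)"
    and cost: "p = \<infinity> \<Longrightarrow> N v1 \<le> \<epsilon> \<and> N v2 \<le> \<epsilon>"
      "p \<noteq> \<infinity> \<Longrightarrow> (\<integral>x. w x \<partial>G) * N v1 powr enn2real p + (1 - (\<integral>x. w x \<partial>G)) * N v2 powr enn2real p
          \<le> \<epsilon> powr enn2real p"
  shows "\<exists>F\<in>wasserstein_ball N p G \<epsilon>. \<forall>\<alpha> b s. 0 < \<alpha> \<longrightarrow> \<alpha> < 1 \<longrightarrow> lin_loss \<alpha> F b s =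
    (\<integral>\<^sup>+ x. ennreal (w x * check_loss \<alpha> (x \<bullet> b + v1 \<bullet> b - s)
       + (1 - w x) * check_loss \<alpha> (x \<bullet> b + v2 \<bullet> b - s)) \<partial>G)"
proof -
  interpret G: prob_space G by fact
  note [measurable_cong] = G(2)
  note [measurable] = w(1) check_loss_measurable is_norm_measurable[OF N]
  obtain Q F where Q: "Q \<in> couplings F G" and F: "prob_space F" "sets F = sets borel"
    and nn: "\<And>f. f\<in>borel_measurable (borel \<Otimes>\<^sub>M borel) \<Longrightarrow> (\<integral>\<^sup>+ \<xi>. f \<xi> \<partial>Q) =
       (\<integral>\<^sup>+ x. ennreal (w x) * f (x + v1, x) + ennreal (1 - w x) * f (x + v2, x) \<partial>G)"
    using split_law[OF G w, of v1 v2] by blast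
  interpret Q: prob_space Q using Q by (simp add: couplings_def)
  have "transport_le N p Q \<epsilon>"
  proof (cases "p = \<infinity>")
    case True
    have Qs: "sets Q = sets (borel \<Otimes>\<^sub>M borel)" using Q by (simp add: couplings_def)
    have [measurable]: "{\<xi>. \<not> N (fst \<xi> - snd \<xi>) \<le> \<epsilon>} \<in> sets (borel \<Otimes>\<^sub>M borel)"
    proof -
      have "{\<xi> \<in> space (borel \<Otimes>\<^sub>M borel). \<not> N (fst \<xi> - snd \<xi>) \<le> \<epsilon>} \<in> sets (borel \<Otimes>\<^sub>M borel)" by measurable
      then show ?thesis by (simp add: space_pair_measure)
    qed
    have "(\<integral>\<^sup>+ \<xi>. indicator {\<xi>. \<not> N (fst \<xi> - snd \<xi>) \<le> \<epsilon>} \<xi> \<partial>Q) = 0"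
      using cost(1)[OF True] by (subst nn) auto
    then have "emeasure Q {\<xi>. \<not> N (fst \<xi> - snd \<xi>) \<le> \<epsilon>} = 0" by (simp add: Qs)
    then have "AE \<xi> in Q. N (fst \<xi> - snd \<xi>) \<le> \<epsilon>"
      by (intro AE_I[of _ _ "{\<xi>. \<not> N (fst \<xi> - snd \<xi>) \<le> \<epsilon>}"]) (auto simp: Qs)
    then show ?thesis using True by (simp add: transport_le_def)
  next
    case False
    let ?r = "enn2real p"
    have iw: "integrable G w"
      by (rule G.integrable_const_bound[of _ 1]) (use w in auto)
    have "(\<integral>\<^sup>+ \<xi>. ennreal (N (fst \<xi> - snd \<xi>) powr ?r) \<partial>Q) =
      (\<integral>\<^sup>+ x. ennreal (w x * N v1 powr ?r + (1 - w x) * N v2 powr ?r) \<partial>G)"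
      using w(2,3) by (subst nn) (auto intro!: nn_integral_cong simp: ennreal_mult')
    also have "\<dots> = ennreal (\<integral>x. w x * N v1 powr ?r + (1 - w x) * N v2 powr ?r \<partial>G)"
      using w(2,3) iw by (intro nn_integral_eq_integral) (auto intro!: AE_I2 add_nonneg_nonneg mult_nonneg_nonneg)
    also have "(\<integral>x. w x * N v1 powr ?r + (1 - w x) * N v2 powr ?r \<partial>G)
       = (\<integral>x. w x \<partial>G) * N v1 powr ?r + (1 - (\<integral>x. w x \<partial>G)) * N v2 powr ?r"
      using iw by (simp add: G.prob_space)
    finally show ?thesis using cost(2)[OF False] False by (simp add: transport_le_def ennreal_leI)
  qed
  then have "F \<in> wasserstein_ball N p G \<epsilon>"
    using transport_le_imp_wasserstein_le[OF N p \<epsilon> Q] F by (simp add: wasserstein_ball_def)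
  moreover have "lin_loss \<alpha> F b s = (\<integral>\<^sup>+ x. ennreal (w x * check_loss \<alpha> (x \<bullet> b + v1 \<bullet> b - s)
       + (1 - w x) * check_loss \<alpha> (x \<bullet> b + v2 \<bullet> b - s)) \<partial>G)" if \<alpha>: "0 < \<alpha>" "\<alpha> < 1" for \<alpha> b s
  proof -
    have "lin_loss \<alpha> F b s = (\<integral>\<^sup>+ \<xi>. ennreal (check_loss \<alpha> (fst \<xi> \<bullet> b - s)) \<partial>Q)"
      unfolding lin_loss_def by (subst nn_integral_coupling(1)[OF Q, symmetric]) auto
    also have "\<dots> = (\<integral>\<^sup>+ x. ennreal (w x * check_loss \<alpha> (x \<bullet> b + v1 \<bullet> b - s)
       + (1 - w x) * check_loss \<alpha> (x \<bullet> b + v2 \<bullet> b - s)) \<partial>G)"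
      using w(2,3) check_loss_nonneg[OF \<alpha>]
      by (subst nn) (auto intro!: nn_integral_cong simp: ennreal_mult' inner_add_left)
    finally show ?thesis .
  qed
  ultimately show ?thesis by blast
qed

text \<open>The trivial displacement. It serves the case of infinite expected loss.\<close>

lemma center_loss_in_ball:
  fixes N :: "'a::euclidean_space \<Rightarrow> real"
  assumes N: "is_norm N" and p: "1 \<le> p" and \<epsilon>: "0 \<le> \<epsilon>"
    and G: "prob_space G" "sets G = sets borel" and \<alpha>: "0 < \<alpha>" "\<alpha> < 1"
  shows "\<exists>F\<in>wasserstein_ball N p G \<epsilon>. \<forall>s. lin_loss \<alpha> F b s = lin_loss \<alpha> G b s"
proof -
  interpret G: prob_space G by fact
  have "\<exists>F\<in>wasserstein_ball N p G \<epsilon>. \<forall>\<alpha> b s. 0 < \<alpha> \<longrightarrow> \<alpha> < 1 \<longrightarrow> lin_loss \<alpha> F b s =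
    (\<integral>\<^sup>+ x. ennreal (1 * check_loss \<alpha> (x \<bullet> b + 0 \<bullet> b - s)
       + (1 - 1) * check_loss \<alpha> (x \<bullet> b + 0 \<bullet> b - s)) \<partial>G)"
    by (rule split_law_in_ball[OF N p \<epsilon> G]) (use is_norm_zero[OF N] \<epsilon> in auto)
  then show ?thesis using \<alpha> by (auto simp: lin_loss_def)
qed

lemma (in real_distribution) quantile_exists:
  assumes "0 < \<alpha>" "\<alpha> < 1"
  shows "\<exists>t. measure M {..<t} \<le> \<alpha> \<and> \<alpha> \<le> measure M {..t}"
proof -
  let ?S = "{t. \<alpha> \<le> cdf M t}"
  have "eventually (\<lambda>x. \<alpha> < cdf M x) at_top"
    using order_tendstoD(1)[OF cdf_lim_at_top_prob] assms by blast
  then obtain x1 where "\<alpha> < cdf M x1" by (auto simp: eventually_at_top_linorder)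
  then have ne: "?S \<noteq> {}" by (auto intro: less_imp_le)
  have "eventually (\<lambda>x. cdf M x < \<alpha>) at_bot"
    using order_tendstoD(2)[OF cdf_lim_at_bot] assms by blast
  then obtain x0 where x0: "\<And>x. x \<le> x0 \<Longrightarrow> cdf M x < \<alpha>" by (auto simp: eventually_at_bot_linorder)
  then have bdd: "bdd_below ?S"
    by (intro bdd_belowI[of _ x0]) (meson linorder_not_le mem_Collect_eq nle_le)
  let ?t = "Inf ?S"
  have "eventually (\<lambda>x. cdf M x \<le> \<alpha>) (at_left ?t)"
  proof -
    have "cdf M x \<le> \<alpha>" if "x < ?t" for x
      using cInf_lower[OF _ bdd, of x] that by force
    then show ?thesis by (auto simp: eventually_at_filter)
  qed
  then have "measure M {..<?t} \<le> \<alpha>"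
    by (intro tendsto_upperbound[OF cdf_at_left]) auto
  moreover have "eventually (\<lambda>x. \<alpha> \<le> cdf M x) (at_right ?t)"
  proof -
    have "\<alpha> \<le> cdf M x" if "?t < x" for x
    proof -
      from that have "\<exists>y\<in>?S. y < x" unfolding cInf_less_iff[OF ne bdd] .
      then obtain y where "y \<in> ?S" "y < x" by blast
      then show ?thesis using cdf_nondecreasing[of y x] by simp
    qed
    then show ?thesis by (auto simp: eventually_at_filter)
  qed
  then have "\<alpha> \<le> cdf M ?t"
    using cdf_is_right_cont[of ?t] by (intro tendsto_lowerbound[of "cdf M"]) (auto simp: continuous_within)
  then have "\<alpha> \<le> measure M {..?t}" by (simp add: cdf_def2)
  ultimately show ?thesis by blast
qed

text \<open>A randomised indicator of the upper tail: an atom at the quantile \<open>t\<close> is split by the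
  proportion \<open>\<theta>\<close> that makes the mass exactly \<open>1 - \<alpha>\<close>.\<close>

lemma (in real_distribution) quantile_weight:
  assumes \<alpha>: "0 < \<alpha>" "\<alpha> < 1"
  shows "\<exists>t w. w \<in> borel_measurable borel \<and> (\<forall>z. 0 \<le> w z \<and> w z \<le> (1::real)) \<and>
     (\<forall>z<t. w z = 0) \<and> (\<forall>z>t. w z = 1) \<and> (\<integral>z. w z \<partial>M) = 1 - \<alpha>"
proof -
  obtain t where t: "measure M {..<t} \<le> \<alpha>" "\<alpha> \<le> measure M {..t}"
    using quantile_exists[OF \<alpha>] by blast
  \<comment> \<open>Without an atom at t the quotient is 0 by convention, and the upper tail itself has mass 1 - \<alpha>.\<close>
  define \<theta> where "\<theta> = (measure M {..t} - \<alpha>) / measure M {t}"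
  define w :: "real \<Rightarrow> real" where "w = (\<lambda>z. indicator {t<..} z + \<theta> * indicator {t} z)"
  have at: "measure M {..t} = measure M {..<t} + measure M {t}"
  proof -
    have "{..t} = {..<t} \<union> {t}" by auto
    then show ?thesis using finite_measure_Union[of "{..<t}" "{t}"] by simp
  qed
  have gt: "measure M {t<..} = 1 - measure M {..t}"
  proof -
    have "{t<..} = space M - {..t}" by auto
    then show ?thesis using prob_compl[of "{..t}"] by simp
  qed
  have \<theta>: "0 \<le> \<theta>" "\<theta> \<le> 1" "\<theta> * measure M {t} = measure M {..t} - \<alpha>"
    using t at by (auto simp: \<theta>_def divide_le_eq_1 zero_le_divide_iff zero_less_measure_iff)
  have "(\<integral>z. w z \<partial>M) = measure M {t<..} + \<theta> * measure M {t}"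
    unfolding w_def by (subst Bochner_Integration.integral_add) (auto simp: integrable_indicator_iff less_top[symmetric])
  then have "(\<integral>z. w z \<partial>M) = 1 - \<alpha>" using \<theta>(3) gt by simp
  moreover have "w \<in> borel_measurable borel" unfolding w_def by measurable
  moreover have "\<forall>z. 0 \<le> w z \<and> w z \<le> 1" "\<forall>z<t. w z = 0" "\<forall>z>t. w z = 1"
    using \<theta> by (auto simp: w_def indicator_def)
  ultimately show ?thesis by blast
qed

text \<open>In particular finiteness of the expected loss does not depend on the intercept.\<close>

lemma lin_loss_finite_iff:
  fixes F :: "'a::euclidean_space measure"
  assumes \<alpha>: "0 < \<alpha>" "\<alpha> < 1" and F: "prob_space F" "sets F = sets borel"
  shows "lin_loss \<alpha> F b s < \<infinity> \<longleftrightarrow> integrable F (\<lambda>\<xi>. \<xi> \<bullet> b)"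
    and "integrable F (\<lambda>\<xi>. \<xi> \<bullet> b) \<Longrightarrow> integrable F (\<lambda>\<xi>. check_loss \<alpha> (\<xi> \<bullet> b - s))"
    and "integrable F (\<lambda>\<xi>. \<xi> \<bullet> b) \<Longrightarrow> lin_loss \<alpha> F b s = ennreal (\<integral>\<xi>. check_loss \<alpha> (\<xi> \<bullet> b - s) \<partial>F)"
proof -
  interpret prob_space F by fact
  note [measurable_cong] = F(2)
  note [measurable] = check_loss_measurable
  note nn = check_loss_nonneg[OF \<alpha>]
  show int: "integrable F (\<lambda>\<xi>. check_loss \<alpha> (\<xi> \<bullet> b - s))" if "integrable F (\<lambda>\<xi>. \<xi> \<bullet> b)"
  proof (rule Bochner_Integration.integrable_bound)
    show "integrable F (\<lambda>\<xi>. \<xi> \<bullet> b - s)" using that by simp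
    show "AE \<xi> in F. norm (check_loss \<alpha> (\<xi> \<bullet> b - s)) \<le> norm (\<xi> \<bullet> b - s)"
      using check_loss_le_abs[OF \<alpha>] nn by simp
  qed measurable
  then show eq: "lin_loss \<alpha> F b s = ennreal (\<integral>\<xi>. check_loss \<alpha> (\<xi> \<bullet> b - s) \<partial>F)"
    if "integrable F (\<lambda>\<xi>. \<xi> \<bullet> b)"
    unfolding lin_loss_def using that nn by (intro nn_integral_eq_integral) auto
  show "lin_loss \<alpha> F b s < \<infinity> \<longleftrightarrow> integrable F (\<lambda>\<xi>. \<xi> \<bullet> b)"
  proof
    assume "lin_loss \<alpha> F b s < \<infinity>"
    then have "integrable F (\<lambda>\<xi>. check_loss \<alpha> (\<xi> \<bullet> b - s))"
      using nn by (intro integrableI_nonneg) (auto simp: lin_loss_def)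
    then have i: "integrable F (\<lambda>\<xi>. check_loss \<alpha> (\<xi> \<bullet> b - s) / min \<alpha> (1 - \<alpha>))" by simp
    have m: "0 < min \<alpha> (1 - \<alpha>)" using \<alpha> by simp
    have "integrable F (\<lambda>\<xi>. \<xi> \<bullet> b - s)"
    proof (rule Bochner_Integration.integrable_bound[OF i])
      have "\<bar>u\<bar> \<le> check_loss \<alpha> u / min \<alpha> (1 - \<alpha>)" for u
        using check_loss_ge_min_abs[OF \<alpha>, of u] m by (simp add: pos_le_divide_eq mult.commute)
      then show "AE \<xi> in F. norm (\<xi> \<bullet> b - s) \<le> norm (check_loss \<alpha> (\<xi> \<bullet> b - s) / min \<alpha> (1 - \<alpha>))"
        unfolding real_norm_def by (intro AE_I2 order_trans[OF _ abs_ge_self])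
    qed measurable
    then have "integrable F (\<lambda>\<xi>. \<xi> \<bullet> b - s + s)" by (rule Bochner_Integration.integrable_add) simp
    then show "integrable F (\<lambda>\<xi>. \<xi> \<bullet> b)" by simp
  qed (simp add: eq)
qed

lemma ennreal_integral_le_nn_integral:
  assumes "integrable M h"
  shows "ennreal (\<integral>x. h x \<partial>M) \<le> (\<integral>\<^sup>+ x. ennreal (h x) \<partial>M)"
proof -
  have "integrable M (\<lambda>x. max 0 (h x))" using assms by (intro integrable_max) auto
  then have "(\<integral>\<^sup>+ x. ennreal (max 0 (h x)) \<partial>M) = ennreal (\<integral>x. max 0 (h x) \<partial>M)"
    by (intro nn_integral_eq_integral) auto
  moreover have "(\<integral>x. h x \<partial>M) \<le> (\<integral>x. max 0 (h x) \<partial>M)"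
    using assms by (intro integral_mono integrable_max) auto
  ultimately show ?thesis by (simp add: ennreal_leI max.commute ennreal_max_0)
qed

lemma ennreal_add_le: "ennreal (x + y) \<le> ennreal x + ennreal y"
  by (cases "0 \<le> x"; cases "0 \<le> y") (auto simp: ennreal_neg intro!: ennreal_leI simp flip: ennreal_plus)

text \<open>The law does not depend on the intercept \<open>s\<close>: its displacement is aligned with the mean-zero
  slopes \<open>\<alpha>\<close> and \<open>-(1 - \<alpha>)\<close> at the quantile \<open>t\<close>, for which the terms in \<open>s\<close> cancel. The magnitudes are those
  of the equality case in Hoelder's inequality, \<open>\<bar>g\<bar> powr (q - 1)\<close> up to normalisation.\<close>

lemma worst_case_exists:
  fixes N :: "'a::euclidean_space \<Rightarrow> real"
  assumes N: "is_norm N" and \<alpha>: "0 < \<alpha>" "\<alpha> < 1" and p: "1 \<le> p" "p \<noteq> 1" and \<epsilon>: "0 \<le> \<epsilon>"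
    and G: "prob_space G" "sets G = sets borel"
  shows "\<exists>F\<in>wasserstein_ball N p G \<epsilon>. \<exists>t. \<forall>s.
    lin_loss \<alpha> G b t + ennreal (check_const \<alpha> p * (\<epsilon> * dual_norm N b)) \<le> lin_loss \<alpha> F b s"
proof (cases "integrable G (\<lambda>\<xi>. \<xi> \<bullet> b)")
  case False
  then have "lin_loss \<alpha> G b s = \<infinity>" for s
    using lin_loss_finite_iff(1)[OF \<alpha> G, of b s] by (simp add: less_top[symmetric])
  moreover obtain F where "F \<in> wasserstein_ball N p G \<epsilon>" "\<And>s. lin_loss \<alpha> F b s = lin_loss \<alpha> G b s"
    using center_loss_in_ball[OF N p(1) \<epsilon> G \<alpha>, of b] by blast
  ultimately show ?thesis by (intro bexI[of _ F]) auto
next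
  case int: True
  interpret G: prob_space G by fact
  note [measurable_cong] = G(2)
  note [measurable] = check_loss_measurable
  let ?D = "dual_norm N b"
  obtain e where e: "N e \<le> 1" "e \<bullet> b = ?D" using dual_norm_attained(1)[OF N] by blast
  have Ne: "0 \<le> N e" using N by (simp add: is_norm_def)
  interpret Z: real_distribution "distr G borel (\<lambda>\<xi>. \<xi> \<bullet> b)" by simp
  obtain t w where w: "w \<in> borel_measurable borel" "\<And>z. 0 \<le> w z" "\<And>z. w z \<le> (1::real)"
      "\<And>z. z < t \<Longrightarrow> w z = 0" "\<And>z. t < z \<Longrightarrow> w z = 1"
      "(\<integral>z. w z \<partial>distr G borel (\<lambda>\<xi>. \<xi> \<bullet> b)) = 1 - \<alpha>"
    using Z.quantile_weight[OF \<alpha>] by blast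
  note [measurable] = w(1)
  let ?w = "\<lambda>\<xi>. w (\<xi> \<bullet> b)"
  have intw: "(\<integral>\<xi>. ?w \<xi> \<partial>G) = 1 - \<alpha>" using w(6) by (subst (asm) integral_distr) auto
  have iw: "integrable G ?w" by (rule G.integrable_const_bound[of _ 1]) (use w in auto)
  define q where "q = enn2real (holder_conj p)"
  define c where "c = check_const \<alpha> p"
  define m1 where "m1 = \<alpha> powr (q - 1) * c powr (1 - q)"
  define m2 where "m2 = (1 - \<alpha>) powr (q - 1) * c powr (1 - q)"
  have m: "0 \<le> m1" "0 \<le> m2" by (auto simp: m1_def m2_def)
  have cm: "\<alpha> * (1 - \<alpha>) * (m1 + m2) = c
    \<and> (p = \<infinity> \<longrightarrow> m1 = 1 \<and> m2 = 1)
    \<and> (p \<noteq> \<infinity> \<longrightarrow> (1 - \<alpha>) * m1 powr enn2real p + \<alpha> * m2 powr enn2real p = 1)"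
    using p(1)
  proof (cases p rule: ennreal_ge_1_cases)
    case infinite
    then have "q = 1" "c = 2 * \<alpha> * (1 - \<alpha>)" using holder_conj_top by (auto simp: q_def c_def check_const_def)
    then show ?thesis using \<alpha> infinite by (simp add: m1_def m2_def)
  next
    case (finite r)
    have qr: "q = r / (r - 1)" using finite by (simp add: q_def holder_conj_ennreal)
    note cc = check_const_finite[OF \<alpha> finite(2), folded qr finite(1), folded c_def]
    have ex: "(q - 1) * r = q" "(1 - q) * r = - q" using finite(2) by (auto simp: qr field_simps)
    have "\<alpha> * (1 - \<alpha>) * (m1 + m2) = (\<alpha> powr q * (1 - \<alpha>) + \<alpha> * (1 - \<alpha>) powr q) * c powr (1 - q)"
    proof -
      have "\<alpha> * \<alpha> powr (q - 1) = \<alpha> powr q" "(1 - \<alpha>) * (1 - \<alpha>) powr (q - 1) = (1 - \<alpha>) powr q"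
        using \<alpha> by (simp_all add: powr_diff)
      then show ?thesis unfolding m1_def m2_def
        by (simp only: distrib_left distrib_right mult.assoc mult.left_commute[of \<alpha> "1 - \<alpha>"]
            flip: mult.assoc) (simp add: mult_ac)
    qed
    also have "\<dots> = c" using cc(3) by (simp add: cc(4)[symmetric] flip: powr_add)
    finally have 1: "\<alpha> * (1 - \<alpha>) * (m1 + m2) = c" .
    have "(1 - \<alpha>) * m1 powr r + \<alpha> * m2 powr r
        = (\<alpha> powr q * (1 - \<alpha>) + \<alpha> * (1 - \<alpha>) powr q) * c powr (- q)"
    proof -
      have "m1 powr r = \<alpha> powr q * c powr (- q)" "m2 powr r = (1 - \<alpha>) powr q * c powr (- q)"
        by (simp_all add: m1_def m2_def powr_mult powr_powr ex)
      then show ?thesis by (simp add: algebra_simps)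
    qed
    also have "\<dots> = 1" using cc(3) by (simp add: cc(4)[symmetric] flip: powr_add)
    finally show ?thesis using 1 finite by simp
  qed (use p(2) in simp)
  \<comment> \<open>Residuals above the quantile are pushed up and those below it are pushed down.\<close>
  define v1 where "v1 = (\<epsilon> * m1) *\<^sub>R e"
  define v2 where "v2 = (- (\<epsilon> * m2)) *\<^sub>R e"
  have Nv: "N v1 \<le> \<epsilon> * m1" "N v2 \<le> \<epsilon> * m2" "0 \<le> N v1" "0 \<le> N v2"
  proof -
    have "N v1 = \<epsilon> * m1 * N e" "N v2 = \<epsilon> * m2 * N e"
      using \<epsilon> m unfolding v1_def v2_def seminorm_onD(3)[OF is_norm_seminorm_on[OF N] UNIV_I] by simp_all
    then show "N v1 \<le> \<epsilon> * m1" "N v2 \<le> \<epsilon> * m2" "0 \<le> N v1" "0 \<le> N v2"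
      using e(1) \<epsilon> m Ne by (auto intro: mult_left_le)
  qed
  have "\<exists>F\<in>wasserstein_ball N p G \<epsilon>. \<forall>\<alpha> b' s. 0 < \<alpha> \<longrightarrow> \<alpha> < 1 \<longrightarrow> lin_loss \<alpha> F b' s =
    (\<integral>\<^sup>+ x. ennreal (?w x * check_loss \<alpha> (x \<bullet> b' + v1 \<bullet> b' - s)
       + (1 - ?w x) * check_loss \<alpha> (x \<bullet> b' + v2 \<bullet> b' - s)) \<partial>G)"
  proof (rule split_law_in_ball[OF N p(1) \<epsilon> G])
    show "N v1 \<le> \<epsilon> \<and> N v2 \<le> \<epsilon>" if "p = \<infinity>" using Nv cm that by simp
    assume fin: "p \<noteq> \<infinity>"
    let ?r = "enn2real p"
    have "(1 - \<alpha>) * N v1 powr ?r + \<alpha> * N v2 powr ?r \<le> (1 - \<alpha>) * (\<epsilon> * m1) powr ?r + \<alpha> * (\<epsilon> * m2) powr ?r"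
      using Nv \<alpha> by (intro add_mono mult_left_mono powr_mono2) auto
    also have "\<dots> = \<epsilon> powr ?r * ((1 - \<alpha>) * m1 powr ?r + \<alpha> * m2 powr ?r)"
      using \<epsilon> m by (simp add: powr_mult algebra_simps)
    also have "\<dots> = \<epsilon> powr ?r" using cm fin by simp
    finally show "(\<integral>x. ?w x \<partial>G) * N v1 powr ?r + (1 - (\<integral>x. ?w x \<partial>G)) * N v2 powr ?r \<le> \<epsilon> powr ?r"
      unfolding intw by simp
  qed (use w in auto)
  then obtain F where F: "F \<in> wasserstein_ball N p G \<epsilon>" and
    FL: "\<And>s. lin_loss \<alpha> F b s = (\<integral>\<^sup>+ x. ennreal (?w x * check_loss \<alpha> (x \<bullet> b + v1 \<bullet> b - s)
       + (1 - ?w x) * check_loss \<alpha> (x \<bullet> b + v2 \<bullet> b - s)) \<partial>G)"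
    using \<alpha> by blast
  have vb: "v1 \<bullet> b = \<epsilon> * ?D * m1" "v2 \<bullet> b = - (\<epsilon> * ?D * m2)"
    using e(2) by (auto simp: v1_def v2_def)
  have "lin_loss \<alpha> G b t + ennreal (check_const \<alpha> p * (\<epsilon> * ?D)) \<le> lin_loss \<alpha> F b s" for s
  proof -
    let ?x1 = "\<epsilon> * ?D * m1" and ?x2 = "\<epsilon> * ?D * m2"
    \<comment> \<open>Replacing the loss by its supporting line with slope \<alpha> on the weight w and slope -(1 - \<alpha>) on the
      weight 1 - w gives h; its mean is independent of s because w has mean 1 - \<alpha>.\<close>
    let ?h = "\<lambda>\<xi>. check_loss \<alpha> (\<xi> \<bullet> b - t) + (?w \<xi> - (1 - \<alpha>)) * (t - s)
      + (?w \<xi> * (\<alpha> * ?x1) + (1 - ?w \<xi>) * ((1 - \<alpha>) * ?x2))"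
    have L: "integrable G (\<lambda>\<xi>. check_loss \<alpha> (\<xi> \<bullet> b - t))"
      by (rule lin_loss_finite_iff(2)[OF \<alpha> G int])
    have ih: "integrable G ?h" using L iw by simp
    have "(\<integral>\<xi>. ?h \<xi> \<partial>G) = (\<integral>\<xi>. check_loss \<alpha> (\<xi> \<bullet> b - t) \<partial>G) + \<alpha> * (1 - \<alpha>) * (m1 + m2) * (\<epsilon> * ?D)"
    proof -
      have "(\<integral>\<xi>. ?h \<xi> \<partial>G) = (\<integral>\<xi>. check_loss \<alpha> (\<xi> \<bullet> b - t) \<partial>G) + ((\<integral>\<xi>. ?w \<xi> \<partial>G) - (1 - \<alpha>)) * (t - s)
        + ((\<integral>\<xi>. ?w \<xi> \<partial>G) * (\<alpha> * ?x1) + (1 - (\<integral>\<xi>. ?w \<xi> \<partial>G)) * ((1 - \<alpha>) * ?x2))"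
        using L iw by (simp add: G.prob_space)
      then show ?thesis unfolding intw by (simp add: algebra_simps)
    qed
    then have H: "(\<integral>\<xi>. ?h \<xi> \<partial>G) = (\<integral>\<xi>. check_loss \<alpha> (\<xi> \<bullet> b - t) \<partial>G) + c * (\<epsilon> * ?D)" using cm by simp
    have pt: "?h \<xi> \<le> ?w \<xi> * check_loss \<alpha> (\<xi> \<bullet> b + v1 \<bullet> b - s) + (1 - ?w \<xi>) * check_loss \<alpha> (\<xi> \<bullet> b + v2 \<bullet> b - s)" for \<xi>
    proof -
      let ?z = "\<xi> \<bullet> b"
      have eq: "check_loss \<alpha> (?z - t) = (?w \<xi> - (1 - \<alpha>)) * (?z - t)"
        using w(4)[of ?z] w(5)[of ?z]
        by (cases ?z t rule: linorder_cases) (auto simp: check_loss_def)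
      have "?w \<xi> * (\<alpha> * (?z + ?x1 - s)) \<le> ?w \<xi> * check_loss \<alpha> (?z + v1 \<bullet> b - s)"
        using check_loss_ge_slope(1)[OF \<alpha>, of "?z + ?x1 - s"] w(2) unfolding vb by (intro mult_left_mono) auto
      moreover have "(1 - ?w \<xi>) * (- (1 - \<alpha>) * (?z - ?x2 - s)) \<le> (1 - ?w \<xi>) * check_loss \<alpha> (?z + v2 \<bullet> b - s)"
        using check_loss_ge_slope(2)[OF \<alpha>, of "?z - ?x2 - s"] w(3) unfolding vb by (intro mult_left_mono) auto
      moreover have "?h \<xi> = ?w \<xi> * (\<alpha> * (?z + ?x1 - s)) + (1 - ?w \<xi>) * (- (1 - \<alpha>) * (?z - ?x2 - s))"
        unfolding eq by (simp add: algebra_simps)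
      ultimately show ?thesis by linarith
    qed
    have "lin_loss \<alpha> G b t + ennreal (c * (\<epsilon> * ?D)) = ennreal (\<integral>\<xi>. ?h \<xi> \<partial>G)"
      unfolding H lin_loss_finite_iff(3)[OF \<alpha> G int]
      using check_const_nonneg[OF \<alpha> p(1)] \<epsilon> dual_norm_nonneg[OF N, of b] check_loss_nonneg[OF \<alpha>]
      by (simp add: c_def)
    also have "\<dots> \<le> (\<integral>\<^sup>+ \<xi>. ennreal (?h \<xi>) \<partial>G)" by (rule ennreal_integral_le_nn_integral[OF ih])
    also have "\<dots> \<le> lin_loss \<alpha> F b s"
      unfolding FL by (intro nn_integral_mono ennreal_leI pt)
    finally show ?thesis by (simp add: c_def)
  qed
  with F show ?thesis by blast
qed

text \<open>For \<open>p = 1\<close> moving the mass \<open>\<delta>\<close> by the distance \<open>\<epsilon> / \<delta>\<close> costs \<open>\<epsilon>\<close>, and raises the expected loss by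
  the steeper slope times \<open>\<epsilon> * dual_norm N b\<close>, up to an error of order \<open>\<delta>\<close>. The supremum need
  not be attained.\<close>

lemma robust_lin_loss_ge_order_1:
  fixes N :: "'a::euclidean_space \<Rightarrow> real"
  assumes N: "is_norm N" and \<alpha>: "0 < \<alpha>" "\<alpha> < 1" and \<epsilon>: "0 \<le> \<epsilon>"
    and G: "prob_space G" "sets G = sets borel"
  shows "lin_loss \<alpha> G b s + ennreal (check_const \<alpha> 1 * (\<epsilon> * dual_norm N b))
    \<le> (SUP F\<in>wasserstein_ball N 1 G \<epsilon>. lin_loss \<alpha> F b s)" (is "?lhs \<le> ?R")
proof (cases "integrable G (\<lambda>\<xi>. \<xi> \<bullet> b)")
  case False
  then have "lin_loss \<alpha> G b s = \<infinity>"
    using lin_loss_finite_iff(1)[OF \<alpha> G, of b s] by (simp add: less_top[symmetric])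
  moreover have "lin_loss \<alpha> G b s \<le> ?R"
    using center_loss_in_ball[OF N order_refl \<epsilon> G \<alpha>, of b] SUP_upper by metis
  ultimately show ?thesis by (simp add: top_unique)
next
  case int: True
  interpret G: prob_space G by fact
  note [measurable_cong] = G(2)
  let ?D = "dual_norm N b"
  let ?u = "\<lambda>\<xi>. \<xi> \<bullet> b - s"
  obtain e where e: "N e \<le> 1" "e \<bullet> b = ?D" using dual_norm_attained(1)[OF N] by blast
  have Ne: "0 \<le> N e" using N by (simp add: is_norm_def)
  have D: "0 \<le> ?D" by (rule dual_norm_nonneg[OF N])
  \<comment> \<open>The direction in which the loss grows faster.\<close>
  define \<sigma> :: real where "\<sigma> = (if 1 - \<alpha> \<le> \<alpha> then 1 else - 1)"
  have \<sigma>: "check_loss \<alpha> (\<sigma> * x) = max \<alpha> (1 - \<alpha>) * x" if "0 \<le> x" for x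
    using that \<alpha> by (auto simp: \<sigma>_def check_loss_def indicator_def)
  let ?a = "\<epsilon> * ?D"
  have iu: "integrable G (\<lambda>\<xi>. \<bar>?u \<xi>\<bar>)" using int by simp
  show ?thesis
  proof (rule ennreal_le_epsilon)
    fix r :: real assume r: "0 < r"
    define K where "K = (\<integral>\<xi>. \<bar>?u \<xi>\<bar> \<partial>G)"
    have K: "0 \<le> K" unfolding K_def by simp
    define \<delta> where "\<delta> = min 1 (r / (K + 1))"
    have \<delta>: "0 < \<delta>" "\<delta> \<le> 1" "\<delta> * K \<le> r"
    proof -
      show "0 < \<delta>" "\<delta> \<le> 1" using r K by (auto simp: \<delta>_def)
      have "\<delta> * K \<le> r / (K + 1) * (K + 1)" using r K by (intro mult_mono) (auto simp: \<delta>_def)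
      then show "\<delta> * K \<le> r" using K by simp
    qed
    define v where "v = (\<sigma> * \<epsilon> / \<delta>) *\<^sub>R e"
    have vb: "v \<bullet> b = \<sigma> * (?a / \<delta>)" using e by (simp add: v_def)
    have "N v = \<epsilon> / \<delta> * N e" using N \<epsilon> \<delta> by (auto simp: v_def is_norm_def \<sigma>_def)
    also have "\<dots> \<le> \<epsilon> / \<delta>" using \<epsilon> \<delta> e Ne by (intro mult_left_le) auto
    finally have Nv: "\<delta> * N v \<le> \<epsilon>" using \<delta> by (simp add: field_simps)
    have Nv0: "0 \<le> N v" using N by (simp add: is_norm_def)
    have "\<exists>F\<in>wasserstein_ball N 1 G \<epsilon>. \<forall>\<alpha> b s. 0 < \<alpha> \<longrightarrow> \<alpha> < 1 \<longrightarrow> lin_loss \<alpha> F b s =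
      (\<integral>\<^sup>+ x. ennreal (\<delta> * check_loss \<alpha> (x \<bullet> b + v \<bullet> b - s)
         + (1 - \<delta>) * check_loss \<alpha> (x \<bullet> b + 0 \<bullet> b - s)) \<partial>G)"
      by (rule split_law_in_ball[OF N order_refl \<epsilon> G])
        (use \<delta> Nv Nv0 \<epsilon> is_norm_zero[OF N] in \<open>auto simp: G.prob_space\<close>)
    then obtain F where F: "F \<in> wasserstein_ball N 1 G \<epsilon>" and
      FL: "lin_loss \<alpha> F b s = (\<integral>\<^sup>+ x. ennreal (\<delta> * check_loss \<alpha> (x \<bullet> b + v \<bullet> b - s)
         + (1 - \<delta>) * check_loss \<alpha> (x \<bullet> b + 0 \<bullet> b - s)) \<partial>G)"
      using \<alpha> by blast
    let ?h = "\<lambda>\<xi>. check_loss \<alpha> (?u \<xi>) + max \<alpha> (1 - \<alpha>) * ?a - \<delta> * \<bar>?u \<xi>\<bar>"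
    have L: "integrable G (\<lambda>\<xi>. check_loss \<alpha> (?u \<xi>))"
      by (rule lin_loss_finite_iff(2)[OF \<alpha> G int])
    have pt: "?h \<xi> \<le> \<delta> * check_loss \<alpha> (\<xi> \<bullet> b + v \<bullet> b - s) + (1 - \<delta>) * check_loss \<alpha> (\<xi> \<bullet> b + 0 \<bullet> b - s)" for \<xi>
    proof -
      have "check_loss \<alpha> (\<sigma> * (?a / \<delta>)) \<le> check_loss \<alpha> (?u \<xi> + v \<bullet> b) + check_loss \<alpha> (- ?u \<xi>)"
        using check_loss_add_le[OF \<alpha>, of "?u \<xi> + v \<bullet> b" "- ?u \<xi>"] by (simp add: vb)
      then have "max \<alpha> (1 - \<alpha>) * (?a / \<delta>) \<le> check_loss \<alpha> (?u \<xi> + v \<bullet> b) + check_loss \<alpha> (- ?u \<xi>)"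
        using \<sigma>[of "?a / \<delta>"] \<epsilon> D \<delta> by simp
      then have "\<delta> * (max \<alpha> (1 - \<alpha>) * (?a / \<delta>)) \<le> \<delta> * (check_loss \<alpha> (?u \<xi> + v \<bullet> b) + check_loss \<alpha> (- ?u \<xi>))"
        using \<delta> by (intro mult_left_mono) auto
      then have "max \<alpha> (1 - \<alpha>) * ?a \<le> \<delta> * check_loss \<alpha> (?u \<xi> + v \<bullet> b) + \<delta> * check_loss \<alpha> (- ?u \<xi>)"
        using \<delta> by (simp add: distrib_left)
      moreover have "\<bar>?u \<xi>\<bar> = check_loss \<alpha> (?u \<xi>) + check_loss \<alpha> (- ?u \<xi>)"
        by (auto simp: check_loss_def indicator_def algebra_simps)
      then have "\<delta> * \<bar>?u \<xi>\<bar> = \<delta> * check_loss \<alpha> (?u \<xi>) + \<delta> * check_loss \<alpha> (- ?u \<xi>)"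
        by (simp add: distrib_left)
      ultimately show ?thesis by (simp add: left_diff_distrib add_diff_eq diff_add_eq)
    qed
    have ih: "integrable G ?h" using L iu by simp
    have "(\<integral>\<xi>. ?h \<xi> \<partial>G) = (\<integral>\<xi>. check_loss \<alpha> (?u \<xi>) \<partial>G) + max \<alpha> (1 - \<alpha>) * ?a - \<delta> * K"
      using L iu by (simp add: G.prob_space K_def)
    then have H: "(\<integral>\<xi>. check_loss \<alpha> (?u \<xi>) \<partial>G) + max \<alpha> (1 - \<alpha>) * ?a \<le> (\<integral>\<xi>. ?h \<xi> \<partial>G) + r"
      using \<delta>(3) by simp
    have "?lhs = ennreal ((\<integral>\<xi>. check_loss \<alpha> (?u \<xi>) \<partial>G) + max \<alpha> (1 - \<alpha>) * ?a)"
      unfolding lin_loss_finite_iff(3)[OF \<alpha> G int]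
      using \<epsilon> D \<alpha> check_loss_nonneg[OF \<alpha>] by (simp add: check_const_def)
    also have "\<dots> \<le> ennreal ((\<integral>\<xi>. ?h \<xi> \<partial>G) + r)" by (rule ennreal_leI[OF H])
    also have "\<dots> \<le> ennreal (\<integral>\<xi>. ?h \<xi> \<partial>G) + ennreal r"
      by (rule ennreal_add_le)
    also have "\<dots> \<le> (\<integral>\<^sup>+ \<xi>. ennreal (?h \<xi>) \<partial>G) + ennreal r"
      by (intro add_right_mono ennreal_integral_le_nn_integral[OF ih])
    also have "\<dots> \<le> lin_loss \<alpha> F b s + ennreal r"
      unfolding FL by (intro add_right_mono nn_integral_mono ennreal_leI pt)
    also have "\<dots> \<le> ?R + ennreal r"
      by (intro add_right_mono SUP_upper F)
    finally show "?lhs \<le> ?R + ennreal r" .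
  qed
qed

lemma exp_loss_eq_lin_loss: "exp_loss \<alpha> F z = lin_loss \<alpha> F (- fst z, 1) (snd z)"
  by (cases z) (auto simp: exp_loss_def lin_loss_def split_beta inner_prod_def inner_commute intro!: nn_integral_cong)

lemma regularized_objective_eq:
  assumes "is_norm N"
  shows "regularized_objective N \<alpha> p \<epsilon> F z =
    lin_loss \<alpha> F (- fst z, 1) (snd z) + ennreal (check_const \<alpha> p * (\<epsilon> * dual_norm N (- fst z, 1)))"
  using dual_norm_minus[OF assms, of "(- fst z, 1)"]
  by (simp add: regularized_objective_def exp_loss_eq_lin_loss mult.assoc)

lemma shifted_intercept_eq:
  assumes "is_norm N"
  shows "shifted_intercept N \<alpha> p \<epsilon> \<beta> s = s + shift_coeff \<alpha> p * (\<epsilon> * dual_norm N (- \<beta>, 1))"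
  using dual_norm_minus[OF assms, of "(- \<beta>, 1)"]
  by (simp add: shifted_intercept_def shift_coeff_def Let_def)

section \<open>The regularised objective: convexity and existence of minimisers\<close>

context
  fixes N :: "(real ^ 'd::finite) \<times> real \<Rightarrow> real"
    and \<alpha> \<epsilon> :: real and p :: ennreal
    and F :: "((real ^ 'd) \<times> real) measure"
  assumes N: "is_norm N" and \<alpha>: "0 < \<alpha>" "\<alpha> < 1" and p: "1 \<le> p" and \<epsilon>: "0 \<le> \<epsilon>"
    and F: "prob_space F" "sets F = sets borel"
begin

lemma regularized_objective_convex: "convex_fun (regularized_objective N \<alpha> p \<epsilon> F)"
  unfolding convex_fun_def
proof (intro allI ballI)
  fix x y :: "(real ^ 'd) \<times> real" and t :: real
  assume "t \<in> {0<..<1}"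
  then have t: "0 \<le> t" "0 \<le> 1 - t" by auto
  note [measurable_cong] = F(2)
  note [measurable] = check_loss_measurable
  let ?z = "(1 - t) *\<^sub>R x + t *\<^sub>R y"
  let ?u = "\<lambda>z \<xi>. \<xi> \<bullet> (- fst z, 1::real) - snd z"
  let ?D = "\<lambda>z. dual_norm N (- fst z, 1)"
  have "lin_loss \<alpha> F (- fst ?z, 1) (snd ?z) \<le>
    (\<integral>\<^sup>+ \<xi>. ennreal (1 - t) * ennreal (check_loss \<alpha> (?u x \<xi>)) + ennreal t * ennreal (check_loss \<alpha> (?u y \<xi>)) \<partial>F)"
    unfolding lin_loss_def
  proof (rule nn_integral_mono)
    fix \<xi> :: "(real ^ 'd) \<times> real"
    have "?u ?z \<xi> = (1 - t) * ?u x \<xi> + t * ?u y \<xi>"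
      by (simp add: inner_prod_def algebra_simps inner_add_right inner_diff_right)
    then have "check_loss \<alpha> (?u ?z \<xi>) \<le> (1 - t) * check_loss \<alpha> (?u x \<xi>) + t * check_loss \<alpha> (?u y \<xi>)"
      using check_loss_add_le[OF \<alpha>, of "(1 - t) * ?u x \<xi>" "t * ?u y \<xi>"] t
      by (simp only: check_loss_scale[OF \<alpha>])
    then have "ennreal (check_loss \<alpha> (?u ?z \<xi>)) \<le> ennreal ((1 - t) * check_loss \<alpha> (?u x \<xi>) + t * check_loss \<alpha> (?u y \<xi>))"
      by (rule ennreal_leI)
    also have "\<dots> = ennreal (1 - t) * ennreal (check_loss \<alpha> (?u x \<xi>)) + ennreal t * ennreal (check_loss \<alpha> (?u y \<xi>))"
      using t check_loss_nonneg[OF \<alpha>] by (simp add: ennreal_mult')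
    finally show "ennreal (check_loss \<alpha> (?u ?z \<xi>)) \<le> \<dots>" .
  qed
  also have "\<dots> = ennreal (1 - t) * lin_loss \<alpha> F (- fst x, 1) (snd x) + ennreal t * lin_loss \<alpha> F (- fst y, 1) (snd y)"
    unfolding lin_loss_def by (simp add: nn_integral_add nn_integral_cmult)
  finally have loss: "lin_loss \<alpha> F (- fst ?z, 1) (snd ?z) \<le>
      ennreal (1 - t) * lin_loss \<alpha> F (- fst x, 1) (snd x) + ennreal t * lin_loss \<alpha> F (- fst y, 1) (snd y)" .
  note s = seminorm_onD[OF seminorm_on_dual_norm[OF N], simplified]
  have "(- fst ?z, 1::real) = (1 - t) *\<^sub>R (- fst x, 1) + t *\<^sub>R (- fst y, 1)" by simp
  then have "?D ?z \<le> (1 - t) * ?D x + t * ?D y"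
    using s(4)[of "(1 - t) *\<^sub>R (- fst x, 1)" "t *\<^sub>R (- fst y, 1)"] t by (simp only: s(3) abs_of_nonneg)
  then have "check_const \<alpha> p * (\<epsilon> * ?D ?z) \<le> check_const \<alpha> p * (\<epsilon> * ((1 - t) * ?D x + t * ?D y))"
    using \<epsilon> check_const_nonneg[OF \<alpha> p] by (intro mult_left_mono)
  also have "\<dots> = (1 - t) * (check_const \<alpha> p * (\<epsilon> * ?D x)) + t * (check_const \<alpha> p * (\<epsilon> * ?D y))"
    by (simp add: algebra_simps)
  finally have "ennreal (check_const \<alpha> p * (\<epsilon> * ?D ?z)) \<le>
      ennreal ((1 - t) * (check_const \<alpha> p * (\<epsilon> * ?D x)) + t * (check_const \<alpha> p * (\<epsilon> * ?D y)))"
    by (rule ennreal_leI)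
  also have "\<dots> = ennreal (1 - t) * ennreal (check_const \<alpha> p * (\<epsilon> * ?D x)) + ennreal t * ennreal (check_const \<alpha> p * (\<epsilon> * ?D y))"
    using t \<epsilon> check_const_nonneg[OF \<alpha> p] dual_norm_nonneg[OF N] by (simp add: ennreal_mult')
  finally have pen: "ennreal (check_const \<alpha> p * (\<epsilon> * ?D ?z)) \<le> \<dots>" .
  show "regularized_objective N \<alpha> p \<epsilon> F ?z \<le>
      ennreal (1 - t) * regularized_objective N \<alpha> p \<epsilon> F x + ennreal t * regularized_objective N \<alpha> p \<epsilon> F y"
    using add_mono[OF loss pen] unfolding regularized_objective_eq[OF N]
    by (simp add: distrib_left add_ac)
qed

text \<open>Around a point \<open>z0\<close> of finite value, the objective is finite exactly on a translate of the subspace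
  \<open>W\<close> of those directions along which the linear form is integrable. There it is coercive and Lipschitz for
  the seminorm \<open>P\<close>, the sum of the mean absolute value of the affine form and the multiple of the
  dual norm occurring in the penalty. The kernel of \<open>P\<close> is nontrivial for instance when \<open>\<epsilon> = 0\<close> and the
  covariates are collinear.\<close>

lemma regularized_objective_attains_min: "\<exists>z. solves (regularized_objective N \<alpha> p \<epsilon> F) z"
proof (cases "\<exists>z. regularized_objective N \<alpha> p \<epsilon> F z < \<infinity>")
  case False
  then show ?thesis by (auto simp: solves_def is_arg_min_def less_top[symmetric])
next
  case True
  then obtain z0 where "regularized_objective N \<alpha> p \<epsilon> F z0 < \<infinity>" by blast
  then have "lin_loss \<alpha> F (- fst z0, 1) (snd z0) < \<infinity>"
    by (simp add: regularized_objective_eq[OF N])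
  then have i0: "integrable F (\<lambda>\<xi>. \<xi> \<bullet> (- fst z0, 1))"
    using lin_loss_finite_iff(1)[OF \<alpha> F, of "(- fst z0, 1)" "snd z0"] by simp
  interpret prob_space F by fact
  note [measurable_cong] = F(2)
  note [measurable] = check_loss_measurable
  define C where "C = check_const \<alpha> p * \<epsilon>"
  have C: "0 \<le> C" using check_const_nonneg[OF \<alpha> p] \<epsilon> by (simp add: C_def)
  define W where "W = {w :: (real ^ 'd) \<times> real. integrable F (\<lambda>\<xi>. fst \<xi> \<bullet> fst w)}"
  define P where "P = (\<lambda>w :: (real ^ 'd) \<times> real. (\<integral>\<xi>. \<bar>fst \<xi> \<bullet> fst w + snd w\<bar> \<partial>F) + C * dual_norm N (fst w, 0))"
  note s = seminorm_onD[OF seminorm_on_dual_norm[OF N], simplified]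
  have iW: "integrable F (\<lambda>\<xi>. \<bar>fst \<xi> \<bullet> fst w + snd w\<bar>)" if "w \<in> W" for w
    using that by (auto simp: W_def)
  have W: "subspace W"
    unfolding W_def subspace_def by (auto simp: inner_add_right)
  have P: "seminorm_on W P"
    unfolding seminorm_on_def
  proof (intro conjI ballI allI W)
    fix w assume w: "w \<in> W"
    show "0 \<le> P w" using C dual_norm_nonneg[OF N] by (auto simp: P_def)
    fix a
    have "\<bar>fst \<xi> \<bullet> fst (a *\<^sub>R w) + snd (a *\<^sub>R w)\<bar> = \<bar>a\<bar> * \<bar>fst \<xi> \<bullet> fst w + snd w\<bar>" for \<xi> :: "(real ^ 'd) \<times> real"
      by (simp flip: abs_mult add: distrib_left)
    moreover have "(fst (a *\<^sub>R w), 0) = a *\<^sub>R (fst w, 0::real)" by simp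
    ultimately show "P (a *\<^sub>R w) = \<bar>a\<bar> * P w"
      unfolding P_def by (simp only: s(3)) (simp add: algebra_simps)
  next
    fix v w assume vw: "v \<in> W" "w \<in> W"
    have "(\<integral>\<xi>. \<bar>fst \<xi> \<bullet> fst (v + w) + snd (v + w)\<bar> \<partial>F)
        \<le> (\<integral>\<xi>. \<bar>fst \<xi> \<bullet> fst v + snd v\<bar> + \<bar>fst \<xi> \<bullet> fst w + snd w\<bar> \<partial>F)"
      using iW[OF vw(1)] iW[OF vw(2)] iW[OF subspace_add[OF W vw]]
      by (intro integral_mono) (auto simp: inner_add_right)
    also have "\<dots> = (\<integral>\<xi>. \<bar>fst \<xi> \<bullet> fst v + snd v\<bar> \<partial>F) + (\<integral>\<xi>. \<bar>fst \<xi> \<bullet> fst w + snd w\<bar> \<partial>F)"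
      using iW[OF vw(1)] iW[OF vw(2)] by simp
    moreover have "C * dual_norm N (fst (v + w), 0) \<le> C * (dual_norm N (fst v, 0) + dual_norm N (fst w, 0))"
      using s(4)[of "(fst v, 0)" "(fst w, 0)"] C by (intro mult_left_mono) auto
    ultimately show "P (v + w) \<le> P v + P w" by (simp add: P_def distrib_left)
  qed
  let ?u = "\<lambda>w \<xi>. \<xi> \<bullet> (- fst (z0 + w), 1::real) - snd (z0 + w)"
  define h where "h = (\<lambda>w. (\<integral>\<xi>. check_loss \<alpha> (?u w \<xi>) \<partial>F) + C * dual_norm N (- fst (z0 + w), 1))"
  have split: "\<xi> \<bullet> (- fst (z0 + w), 1) = \<xi> \<bullet> (- fst z0, 1) - fst \<xi> \<bullet> fst w" for w and \<xi> :: "(real ^ 'd) \<times> real"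
    by (simp add: inner_prod_def inner_diff_right)
  have W_iff: "integrable F (\<lambda>\<xi>. \<xi> \<bullet> (- fst (z0 + w), 1)) \<longleftrightarrow> w \<in> W" for w
  proof
    assume "integrable F (\<lambda>\<xi>. \<xi> \<bullet> (- fst (z0 + w), 1))"
    from Bochner_Integration.integrable_diff[OF i0 this] show "w \<in> W"
      unfolding split W_def by simp
  next
    assume "w \<in> W"
    then show "integrable F (\<lambda>\<xi>. \<xi> \<bullet> (- fst (z0 + w), 1))"
      unfolding split using i0 by (simp add: W_def)
  qed
  have reg: "regularized_objective N \<alpha> p \<epsilon> F (z0 + w) = ennreal (h w)" if "w \<in> W" for w
  proof -
    have "lin_loss \<alpha> F (- fst (z0 + w), 1) (snd (z0 + w)) = ennreal (\<integral>\<xi>. check_loss \<alpha> (?u w \<xi>) \<partial>F)"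
      using that by (intro lin_loss_finite_iff(3)[OF \<alpha> F]) (simp only: W_iff)
    moreover have "0 \<le> (\<integral>\<xi>. check_loss \<alpha> (?u w \<xi>) \<partial>F)" "0 \<le> C * dual_norm N (- fst (z0 + w), 1)"
      using C dual_norm_nonneg[OF N] check_loss_nonneg[OF \<alpha>] by simp_all
    ultimately show ?thesis
      unfolding regularized_objective_eq[OF N] h_def by (simp add: C_def mult.assoc)
  qed
  have reg_top: "regularized_objective N \<alpha> p \<epsilon> F (z0 + w) = \<infinity>" if "w \<notin> W" for w
  proof -
    have "\<not> lin_loss \<alpha> F (- fst (z0 + w), 1) (snd (z0 + w)) < \<infinity>"
      using that unfolding lin_loss_finite_iff(1)[OF \<alpha> F] W_iff .
    then show ?thesis unfolding regularized_objective_eq[OF N] by (simp add: less_top[symmetric])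
  qed
  have iL: "integrable F (\<lambda>\<xi>. check_loss \<alpha> (?u w \<xi>))" if "w \<in> W" for w
    using lin_loss_finite_iff(2)[OF \<alpha> F] W_iff that by blast
  have u_diff: "?u v \<xi> - ?u w \<xi> = - (fst \<xi> \<bullet> fst (v - w) + snd (v - w))" for v w and \<xi> :: "(real ^ 'd) \<times> real"
    unfolding split by (simp add: inner_diff_right)
  have dual_lip: "\<bar>dual_norm N (- fst (z0 + v), 1) - dual_norm N (- fst (z0 + w), 1)\<bar> \<le> dual_norm N (fst (v - w), 0)" for v w
  proof -
    have "(- fst (z0 + v), 1) - (- fst (z0 + w), 1) = - (fst (v - w), 0::real)" by simp
    then show ?thesis
      using seminorm_on_diff[OF seminorm_on_dual_norm[OF N], of "(- fst (z0 + v), 1)" "(- fst (z0 + w), 1)"]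
      by (simp only: dual_norm_minus[OF N] UNIV_I simp_thms)
  qed
  have "\<exists>x\<in>W. \<forall>y\<in>W. h x \<le> h y"
  proof (rule seminorm_coercive_attains_min[OF P])
    fix v w assume vw: "v \<in> W" "w \<in> W"
    have vw': "v - w \<in> W" using subspace_diff[OF W vw] .
    have "\<bar>(\<integral>\<xi>. check_loss \<alpha> (?u v \<xi>) \<partial>F) - (\<integral>\<xi>. check_loss \<alpha> (?u w \<xi>) \<partial>F)\<bar>
        = \<bar>\<integral>\<xi>. check_loss \<alpha> (?u v \<xi>) - check_loss \<alpha> (?u w \<xi>) \<partial>F\<bar>"
      using iL[OF vw(1)] iL[OF vw(2)] by simp
    also have "\<dots> \<le> (\<integral>\<xi>. \<bar>check_loss \<alpha> (?u v \<xi>) - check_loss \<alpha> (?u w \<xi>)\<bar> \<partial>F)"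
      by (rule integral_abs_bound)
    also have "\<dots> \<le> (\<integral>\<xi>. \<bar>fst \<xi> \<bullet> fst (v - w) + snd (v - w)\<bar> \<partial>F)"
    proof (rule integral_mono)
      show "integrable F (\<lambda>\<xi>. \<bar>check_loss \<alpha> (?u v \<xi>) - check_loss \<alpha> (?u w \<xi>)\<bar>)"
        using iL[OF vw(1)] iL[OF vw(2)] by simp
      fix \<xi>
      show "\<bar>check_loss \<alpha> (?u v \<xi>) - check_loss \<alpha> (?u w \<xi>)\<bar> \<le> \<bar>fst \<xi> \<bullet> fst (v - w) + snd (v - w)\<bar>"
        using check_loss_lipschitz[OF \<alpha>, of "?u v \<xi>" "?u w \<xi>"] unfolding u_diff by simp
    qed (rule iW[OF vw'])
    finally have 1: "\<bar>(\<integral>\<xi>. check_loss \<alpha> (?u v \<xi>) \<partial>F) - (\<integral>\<xi>. check_loss \<alpha> (?u w \<xi>) \<partial>F)\<bar>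
        \<le> (\<integral>\<xi>. \<bar>fst \<xi> \<bullet> fst (v - w) + snd (v - w)\<bar> \<partial>F)" .
    have "\<bar>C * dual_norm N (- fst (z0 + v), 1) - C * dual_norm N (- fst (z0 + w), 1)\<bar>
        = C * \<bar>dual_norm N (- fst (z0 + v), 1) - dual_norm N (- fst (z0 + w), 1)\<bar>"
      using C by (simp only: right_diff_distrib[symmetric] abs_mult abs_of_nonneg)
    also have "\<dots> \<le> C * dual_norm N (fst (v - w), 0)"
      by (rule mult_left_mono[OF dual_lip C])
    finally show "\<bar>h v - h w\<bar> \<le> P (v - w)" using 1 unfolding h_def P_def by linarith
  next
    let ?m = "min \<alpha> (1 - \<alpha>)"
    show m: "0 < ?m" using \<alpha> by simp
    fix w assume w: "w \<in> W"
    have 0: "0 \<in> W" using W by (rule subspace_0)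
    have iu: "integrable F (\<lambda>\<xi>. \<bar>?u 0 \<xi>\<bar>)" using i0 by simp
    have "?m * (\<integral>\<xi>. \<bar>fst \<xi> \<bullet> fst w + snd w\<bar> \<partial>F) - ?m * (\<integral>\<xi>. \<bar>?u 0 \<xi>\<bar> \<partial>F)
        = (\<integral>\<xi>. ?m * \<bar>fst \<xi> \<bullet> fst w + snd w\<bar> - ?m * \<bar>?u 0 \<xi>\<bar> \<partial>F)"
      using iW[OF w] iu by simp
    also have "\<dots> \<le> (\<integral>\<xi>. check_loss \<alpha> (?u w \<xi>) \<partial>F)"
    proof (rule integral_mono)
      fix \<xi> :: "(real ^ 'd) \<times> real"
      have "\<bar>fst \<xi> \<bullet> fst w + snd w\<bar> \<le> \<bar>?u w \<xi>\<bar> + \<bar>?u 0 \<xi>\<bar>"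
        using u_diff[of \<xi> w 0] by simp
      then have "?m * \<bar>fst \<xi> \<bullet> fst w + snd w\<bar> \<le> ?m * (\<bar>?u w \<xi>\<bar> + \<bar>?u 0 \<xi>\<bar>)"
        using m by (intro mult_left_mono) auto
      then show "?m * \<bar>fst \<xi> \<bullet> fst w + snd w\<bar> - ?m * \<bar>?u 0 \<xi>\<bar> \<le> check_loss \<alpha> (?u w \<xi>)"
        using check_loss_ge_min_abs[OF \<alpha>, of "?u w \<xi>"] unfolding distrib_left by linarith
    next
      show "integrable F (\<lambda>\<xi>. ?m * \<bar>fst \<xi> \<bullet> fst w + snd w\<bar> - ?m * \<bar>?u 0 \<xi>\<bar>)"
        using iW[OF w] iu by (intro Bochner_Integration.integrable_diff integrable_mult_right) auto
    qed (rule iL[OF w])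
    finally have 1: "?m * (\<integral>\<xi>. \<bar>fst \<xi> \<bullet> fst w + snd w\<bar> \<partial>F) - ?m * (\<integral>\<xi>. \<bar>?u 0 \<xi>\<bar> \<partial>F)
        \<le> (\<integral>\<xi>. check_loss \<alpha> (?u w \<xi>) \<partial>F)" .
    have "(fst w, 0) = (- fst (z0 + 0), 1) + - (- fst (z0 + w), 1::real)" by simp
    then have "dual_norm N (fst w, 0) \<le> dual_norm N (- fst (z0 + 0), 1) + dual_norm N (- fst (z0 + w), 1)"
      using s(4)[of "(- fst (z0 + 0), 1)" "- (- fst (z0 + w), 1)"] by (simp only: dual_norm_minus[OF N])
    then have "?m * (C * dual_norm N (fst w, 0)) \<le> ?m * (C * (dual_norm N (- fst (z0 + 0), 1) + dual_norm N (- fst (z0 + w), 1)))"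
      using m C by (intro mult_left_mono) auto
    also have "\<dots> \<le> 1 * (C * (dual_norm N (- fst (z0 + 0), 1) + dual_norm N (- fst (z0 + w), 1)))"
      using \<alpha> C dual_norm_nonneg[OF N] by (intro mult_right_mono mult_nonneg_nonneg add_nonneg_nonneg) auto
    finally have 2: "?m * (C * dual_norm N (fst w, 0))
        \<le> C * dual_norm N (- fst (z0 + 0), 1) + C * dual_norm N (- fst (z0 + w), 1)"
      by (simp only: mult_1 distrib_left)
    show "?m * P w - (?m * (\<integral>\<xi>. \<bar>?u 0 \<xi>\<bar> \<partial>F) + C * dual_norm N (- fst (z0 + 0), 1)) \<le> h w"
      using 1 2 unfolding h_def P_def distrib_left by linarith
  qed
  then obtain x where x: "x \<in> W" "\<And>y. y \<in> W \<Longrightarrow> h x \<le> h y" by blast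
  have "regularized_objective N \<alpha> p \<epsilon> F (z0 + x) \<le> regularized_objective N \<alpha> p \<epsilon> F z" for z
  proof (cases "z - z0 \<in> W")
    case True
    then show ?thesis using reg[OF x(1)] reg[OF True] x(2)[OF True] by (simp add: ennreal_leI)
  next
    case False
    then show ?thesis using reg_top[OF False] by simp
  qed
  then have "solves (regularized_objective N \<alpha> p \<epsilon> F) (z0 + x)"
    by (auto simp: solves_def is_arg_min_def not_less)
  then show ?thesis ..
qed

section \<open>Comparison of the two problems\<close>

lemma robust_objective_shifted_le:
  "robust_objective N \<alpha> p \<epsilon> F (\<beta>, shifted_intercept N \<alpha> p \<epsilon> \<beta> s) \<le> regularized_objective N \<alpha> p \<epsilon> F (\<beta>, s)"
  unfolding robust_objective_def
  using robust_lin_loss_le[OF N \<alpha> p \<epsilon>, of "(- \<beta>, 1)"]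
  by (intro SUP_least) (simp add: exp_loss_eq_lin_loss regularized_objective_eq[OF N] shifted_intercept_eq[OF N] zero_prod_def)

text \<open>Unless \<open>p = 1\<close>, only the infimum over the intercept can be compared: at a fixed intercept the
  robust objective may be smaller than the regularised one.\<close>

lemma INF_regularized_le_robust:
  "(INF z. regularized_objective N \<alpha> p \<epsilon> F z) \<le> robust_objective N \<alpha> p \<epsilon> F (\<beta>, s)"
proof (cases "p = 1")
  case True
  have "regularized_objective N \<alpha> p \<epsilon> F (\<beta>, s) \<le> robust_objective N \<alpha> p \<epsilon> F (\<beta>, s)"
    using robust_lin_loss_ge_order_1[OF N \<alpha> \<epsilon> F, of "(- \<beta>, 1)" s] True
    by (simp add: robust_objective_def exp_loss_eq_lin_loss regularized_objective_eq[OF N])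
  then show ?thesis by (rule INF_lower2[OF UNIV_I])
next
  case False
  obtain G t where G: "G \<in> wasserstein_ball N p F \<epsilon>" "\<And>s. lin_loss \<alpha> F (- \<beta>, 1) t + ennreal (check_const \<alpha> p * (\<epsilon> * dual_norm N (- \<beta>, 1))) \<le> lin_loss \<alpha> G (- \<beta>, 1) s"
    using worst_case_exists[OF N \<alpha> p False \<epsilon> F, of "(- \<beta>, 1)"] by blast
  have "(INF z. regularized_objective N \<alpha> p \<epsilon> F z) \<le> regularized_objective N \<alpha> p \<epsilon> F (\<beta>, t)"
    by (rule INF_lower) simp
  also have "\<dots> \<le> lin_loss \<alpha> G (- \<beta>, 1) s" using G(2) by (simp add: regularized_objective_eq[OF N])
  also have "\<dots> \<le> robust_objective N \<alpha> p \<epsilon> F (\<beta>, s)"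
    unfolding robust_objective_def exp_loss_eq_lin_loss using G(1) by (auto intro: SUP_upper2)
  finally show ?thesis .
qed

end

theorem theorem1:
  fixes N :: "(real ^ 'd::finite) \<times> real \<Rightarrow> real"
    and \<alpha> \<epsilon> :: real and p :: ennreal
    and F\<^sub>0 :: "((real ^ 'd) \<times> real) measure"
  assumes "is_norm N"
    and "0 < \<alpha>" "\<alpha> < 1"
    and "1 \<le> p"
    and "0 \<le> \<epsilon>"
    and "prob_space F\<^sub>0" "sets F\<^sub>0 = sets borel"
  shows "convex_fun (regularized_objective N \<alpha> p \<epsilon> F\<^sub>0)
    \<and> (\<exists>z. solves (regularized_objective N \<alpha> p \<epsilon> F\<^sub>0) z)
    \<and> (INF z. robust_objective N \<alpha> p \<epsilon> F\<^sub>0 z) = (INF z. regularized_objective N \<alpha> p \<epsilon> F\<^sub>0 z)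
    \<and> (\<forall>\<beta> s. solves (regularized_objective N \<alpha> p \<epsilon> F\<^sub>0) (\<beta>, s) \<longrightarrow>
          solves (robust_objective N \<alpha> p \<epsilon> F\<^sub>0) (\<beta>, shifted_intercept N \<alpha> p \<epsilon> \<beta> s))"
proof (intro conjI allI impI)
  let ?P = "robust_objective N \<alpha> p \<epsilon> F\<^sub>0" and ?R = "regularized_objective N \<alpha> p \<epsilon> F\<^sub>0"
  note le = robust_objective_shifted_le[OF assms] and ge = INF_regularized_le_robust[OF assms]
  show "convex_fun ?R" by (rule regularized_objective_convex[OF assms])
  show "\<exists>z. solves ?R z" by (rule regularized_objective_attains_min[OF assms])
  show "(INF z. ?P z) = (INF z. ?R z)"
  proof (rule antisym)
    show "(INF z. ?P z) \<le> (INF z. ?R z)"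
      using le by (intro INF_greatest) (auto intro: INF_lower2 simp: split_paired_all)
    show "(INF z. ?R z) \<le> (INF z. ?P z)"
      using ge by (intro INF_greatest) (auto simp: split_paired_all)
  qed
  fix \<beta> s assume "solves ?R (\<beta>, s)"
  then have min: "?R (\<beta>, s) \<le> ?R z" for z
    by (cases z) (auto simp: solves_def is_arg_min_def not_less)
  have "?P (\<beta>, shifted_intercept N \<alpha> p \<epsilon> \<beta> s) \<le> ?P z" for z
  proof -
    have "?P (\<beta>, shifted_intercept N \<alpha> p \<epsilon> \<beta> s) \<le> ?R (\<beta>, s)" by (rule le)
    also have "\<dots> \<le> (INF z. ?R z)" using min by (intro INF_greatest)
    also have "\<dots> \<le> ?P z" using ge[of "fst z" "snd z"] by simp
    finally show ?thesis .
  qed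
  then show "solves ?P (\<beta>, shifted_intercept N \<alpha> p \<epsilon> \<beta> s)"
    by (auto simp: solves_def is_arg_min_def not_less)
qed

end
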